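(* Let $B\subset X$ be a ball such that $X\setminus\overline{B}$ is nonempty. For every $E\subset B$ we have $$\mathrm{cap}_{\mathrm{BV},\mathrm{O}}(E,B)\approx\mathrm{Cap}_{\mathrm{BV},\mathrm{O}}(E,B),$$ with the constants of comparison depending solely on the doubling constant, the Poincaré constants, and the ball $B$.
   Context: Notation: $a\approx b$ means that there is a constant $C\ge1$ (the constant of comparison) with $C^{-1}a\le b\le Ca$. Standing assumptions: $X=(X,d,\mu)$ is a complete metric space with a Borel regular outer measure $\mu$, $0<\mu(B)<\infty$ for all balls $B$, which is doubling: there is a constant $C_D$ (the doubling constant) with $\mu(2B)\le C_D\mu(B)$ for all balls $B$. Moreover $X$ supports a weak $(1,1)$-Poincaré inequality: there are constants $C_P>0$, $\tau\ge 1$ (the Poincaré constants) such that for all balls $B(x,r)$, all locally integrable $u$ on $X$ and all $1$-weak upper gradients $g$ of $u$, $$\frac{1}{\mu(B(x,r))}\int_{B(x,r)}|u-u_{B(x,r)}|\,d\mu\le C_P\,r\,\frac{1}{\mu(B(x,\tau r))}\int_{B(x,\tau r)}g\,d\mu,$$ where $u_{B(x,r)}=\frac{1}{\mu(B(x,r))}\int_{B(x,r)}u\,d\mu$. Balls are open. Paths and upper gradients: A path is a rectifiable nonconstant continuous mapping from a compact interval to $X$. A nonnegative Borel function $g$ on an open set $\Omega$ is an upper gradient of an extended real valued function $u$ on $\Omega$ if for all paths $\gamma$ in $\Omega$ with endpoints $x,y$: $|u(x)-u(y)|\le\int_\gamma g\,ds$ whenever $u(x),u(y)$ are both finite, and $\int_\gamma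 g\,ds=\infty$ otherwise. The $1$-modulus of a collection $\Gamma$ of paths in $\Omega$ is $\inf_\varrho\int_\Omega\varrho\,d\mu$, over all nonnegative Borel $\varrho$ with $\int_\gamma\varrho\,ds\ge1$ for every $\gamma\in\Gamma$. A nonnegative measurable $g$ is a $1$-weak upper gradient of $u$ if the upper gradient inequality holds (with $\int_\gamma g\,ds$ well defined) for all paths outside a family of zero $1$-modulus. BV functions: for $\Omega\subset X$ open and $u\in L^1_{\mathrm{loc}}(\Omega)$ the total variation is $\|Du\|(\Omega)=\inf\liminf_{i\to\infty}\int_\Omega g_{u_i}\,d\mu$, where $g_{u_i}$ is an upper gradient of $u_i$ and the infimum is over all sequences of locally Lipschitz functions $u_i$ on $\Omega$ with $u_i\to u$ in $L^1_{\mathrm{loc}}(\Omega)$. $\mathrm{BV}(\Omega)$ is the set of $u\in L^1(\Omega)$ with $\|Du\|(\Omega)<\infty$. Capacities: for a ball $B\subset X$ and $E\subset B$, $$\mathrm{cap}_{\mathrm{BV},\mathrm{O}}(E,B)=\inf\|Du\|(B),\qquad \mathrm{Cap}_{\mathrm{BV},\mathrm{O}}(E,B)=\inf\Big(\int_B|u|\,d\mu+\|Du\|(B)\Big),$$ both infima over all $u\in\mathrm{BV}(B)$ such that $u=1$ in a neighborhood of $E$ and $u$ has compact support in $B$; the infimum is $\infty$ if there are no such functions. *)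

theory Defs
  imports "HOL-Analysis.Analysis"
begin

section \<open>Borel regular outer measures\<close>

definition borel_regular_outer_measure :: "('a::topological_space set \<Rightarrow> ennreal) \<Rightarrow> bool" where
  "borel_regular_outer_measure \<mu> \<longleftrightarrow>
     outer_measure_space UNIV \<mu> \<and>
     sets borel \<subseteq> lambda_system UNIV UNIV \<mu> \<and>
     (\<forall>A. \<exists>B\<in>sets borel. A \<subseteq> B \<and> \<mu> B = \<mu> A)"

text \<open>
  \<^term>\<open>lambda_system UNIV UNIV \<mu>\<close> is the sigma-algebra of all Caratheodory measurable sets, so
  this is the complete measure space belonging to the outer measure.
\<close>

definition outer_to_measure :: "('a set \<Rightarrow> ennreal) \<Rightarrow> 'a measure" where
  "outer_to_measure \<mu> = measure_of UNIV (lambda_system UNIV UNIV \<mu>) \<mu>"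

lemma
  assumes "outer_measure_space UNIV \<mu>"
  shows sets_outer_to_measure: "sets (outer_to_measure \<mu>) = lambda_system UNIV UNIV \<mu>"
    and emeasure_outer_to_measure:
      "A \<in> lambda_system UNIV UNIV \<mu> \<Longrightarrow> emeasure (outer_to_measure \<mu>) A = \<mu> A"
proof -
  interpret sigma_algebra UNIV "UNIV :: 'a set set"
    using sigma_algebra_Pow[of "UNIV :: 'a set"] by simp
  have ms: "measure_space UNIV (lambda_system UNIV UNIV \<mu>) \<mu>"
    using assms by (rule caratheodory_lemma)
  then have sa: "sigma_algebra UNIV (lambda_system UNIV UNIV \<mu>)"
    by (simp add: measure_space_def)
  show "sets (outer_to_measure \<mu>) = lambda_system UNIV UNIV \<mu>"
    by (simp add: outer_to_measure_def sigma_algebra.sigma_sets_eq[OF sa])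
  show "emeasure (outer_to_measure \<mu>) A = \<mu> A" if "A \<in> lambda_system UNIV UNIV \<mu>"
    using that ms by (simp add: outer_to_measure_def measure_space_def emeasure_measure_of_sigma)
qed

definition positive_finite_on_balls :: "('a::metric_space set \<Rightarrow> ennreal) \<Rightarrow> bool" where
  "positive_finite_on_balls \<mu> \<longleftrightarrow> (\<forall>x r. 0 < r \<longrightarrow> 0 < \<mu> (ball x r) \<and> \<mu> (ball x r) < \<infinity>)"

definition doubling_measure :: "('a::metric_space set \<Rightarrow> ennreal) \<Rightarrow> real \<Rightarrow> bool" where
  "doubling_measure \<mu> C\<^sub>D \<longleftrightarrow>
     (\<forall>x r. 0 < r \<longrightarrow> \<mu> (ball x (2 * r)) \<le> ennreal C\<^sub>D * \<mu> (ball x r))"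


section \<open>Paths and line integrals\<close>

definition curve_length :: "(real \<Rightarrow> 'a::metric_space) \<Rightarrow> real \<Rightarrow> real \<Rightarrow> ennreal" where
  "curve_length \<gamma> a b =
     (SUP (n, p) \<in> {(n :: nat, p :: nat \<Rightarrow> real). mono_on {..n} p \<and> p ` {..n} \<subseteq> {a..b}}.
        \<Sum>i<n. ennreal (dist (\<gamma> (p i)) (\<gamma> (p (Suc i)))))"

text \<open>
  All paths are parametrized on the unit interval, as everywhere in the library; line integrals do
  not depend on the parametrization.
\<close>

definition rect_paths :: "'a::metric_space set \<Rightarrow> (real \<Rightarrow> 'a) set" where
  "rect_paths \<Omega> =
     {\<gamma>. path \<gamma> \<and> path_image \<gamma> \<subseteq> \<Omega> \<and> curve_length \<gamma> 0 1 < \<infinity> \<and> \<not> \<gamma> constant_on {0..1}}"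

text \<open>
  The arc-length parametrization: the choice of the parameter is immaterial, because a path is
  constant between two parameters with the same arc length.
\<close>

definition arclength_param :: "(real \<Rightarrow> 'a::metric_space) \<Rightarrow> real \<Rightarrow> 'a" where
  "arclength_param \<gamma> s = \<gamma> (SOME t. t \<in> {0..1} \<and> curve_length \<gamma> 0 t = ennreal s)"

definition line_integral_defined :: "('a::metric_space \<Rightarrow> ennreal) \<Rightarrow> (real \<Rightarrow> 'a) \<Rightarrow> bool" where
  "line_integral_defined g \<gamma> \<longleftrightarrow>
     (\<lambda>s. g (arclength_param \<gamma> s))
       \<in> borel_measurable (lebesgue_on {0..enn2real (curve_length \<gamma> 0 1)})"

definition line_integral :: "('a::metric_space \<Rightarrow> ennreal) \<Rightarrow> (real \<Rightarrow> 'a) \<Rightarrow> ennreal" where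
  "line_integral g \<gamma> =
     (\<integral>\<^sup>+s\<in>{0..enn2real (curve_length \<gamma> 0 1)}. g (arclength_param \<gamma> s) \<partial>lebesgue)"


section \<open>Upper gradients\<close>

definition upper_gradient_ineq ::
    "('a::metric_space \<Rightarrow> ereal) \<Rightarrow> ('a \<Rightarrow> ennreal) \<Rightarrow> (real \<Rightarrow> 'a) \<Rightarrow> bool" where
  "upper_gradient_ineq u g \<gamma> \<longleftrightarrow>
     (if \<bar>u (pathstart \<gamma>)\<bar> \<noteq> \<infinity> \<and> \<bar>u (pathfinish \<gamma>)\<bar> \<noteq> \<infinity>
      then \<bar>u (pathstart \<gamma>) - u (pathfinish \<gamma>)\<bar> \<le> enn2ereal (line_integral g \<gamma>)
      else line_integral g \<gamma> = \<infinity>)"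

definition upper_gradient ::
    "'a::metric_space set \<Rightarrow> ('a \<Rightarrow> ereal) \<Rightarrow> ('a \<Rightarrow> ennreal) \<Rightarrow> bool" where
  "upper_gradient \<Omega> u g \<longleftrightarrow>
     g \<in> borel_measurable (restrict_space borel \<Omega>) \<and>
     (\<forall>\<gamma>\<in>rect_paths \<Omega>. upper_gradient_ineq u g \<gamma>)"

definition modulus1 ::
    "('a::metric_space set \<Rightarrow> ennreal) \<Rightarrow> 'a set \<Rightarrow> (real \<Rightarrow> 'a) set \<Rightarrow> ennreal" where
  "modulus1 \<mu> \<Omega> \<Gamma> =
     (INF \<rho> \<in> {\<rho>. \<rho> \<in> borel_measurable (restrict_space borel \<Omega>) \<and>
                   (\<forall>\<gamma>\<in>\<Gamma>. 1 \<le> line_integral \<rho> \<gamma>)}.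
        \<integral>\<^sup>+x\<in>\<Omega>. \<rho> x \<partial>outer_to_measure \<mu>)"

definition weak_upper_gradient1 ::
    "('a::metric_space set \<Rightarrow> ennreal) \<Rightarrow> 'a set \<Rightarrow> ('a \<Rightarrow> ereal) \<Rightarrow> ('a \<Rightarrow> ennreal) \<Rightarrow> bool" where
  "weak_upper_gradient1 \<mu> \<Omega> u g \<longleftrightarrow>
     g \<in> borel_measurable (restrict_space (outer_to_measure \<mu>) \<Omega>) \<and>
     (\<exists>\<Gamma>\<subseteq>rect_paths \<Omega>. modulus1 \<mu> \<Omega> \<Gamma> = 0 \<and>
        (\<forall>\<gamma>\<in>rect_paths \<Omega> - \<Gamma>. line_integral_defined g \<gamma> \<and> upper_gradient_ineq u g \<gamma>))"


section \<open>The weak (1,1)-Poincare inequality\<close>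

text \<open>
  In a complete space with a doubling measure closed bounded sets are compact, so testing local
  integrability and convergence on compact sets or on neighbourhoods of points amounts to the same.
\<close>

definition locally_integrable ::
    "('a::metric_space set \<Rightarrow> ennreal) \<Rightarrow> 'a set \<Rightarrow> ('a \<Rightarrow> ereal) \<Rightarrow> bool" where
  "locally_integrable \<mu> \<Omega> u \<longleftrightarrow>
     u \<in> borel_measurable (restrict_space (outer_to_measure \<mu>) \<Omega>) \<and>
     (\<forall>K. compact K \<and> K \<subseteq> \<Omega> \<longrightarrow> (\<integral>\<^sup>+x\<in>K. e2ennreal \<bar>u x\<bar> \<partial>outer_to_measure \<mu>) < \<infinity>)"

text \<open>
  An integrable \<^term>\<open>u\<close> is finite almost everywhere, so applying \<^const>\<open>real_of_ereal\<close> does not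
  change its integral.
\<close>

definition mean_value ::
    "('a::metric_space set \<Rightarrow> ennreal) \<Rightarrow> 'a set \<Rightarrow> ('a \<Rightarrow> ereal) \<Rightarrow> real" where
  "mean_value \<mu> A u = (LINT x:A|outer_to_measure \<mu>. real_of_ereal (u x)) / enn2real (\<mu> A)"

definition weak_poincare11 :: "('a::metric_space set \<Rightarrow> ennreal) \<Rightarrow> real \<Rightarrow> real \<Rightarrow> bool" where
  "weak_poincare11 \<mu> C\<^sub>P \<tau> \<longleftrightarrow>
     (\<forall>x r u g. 0 < r \<and> locally_integrable \<mu> UNIV u \<and> weak_upper_gradient1 \<mu> UNIV u g \<longrightarrow>
        (\<integral>\<^sup>+y\<in>ball x r. e2ennreal \<bar>u y - ereal (mean_value \<mu> (ball x r) u)\<bar>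
            \<partial>outer_to_measure \<mu>) / \<mu> (ball x r)
        \<le> ennreal (C\<^sub>P * r) *
          ((\<integral>\<^sup>+y\<in>ball x (\<tau> * r). g y \<partial>outer_to_measure \<mu>) / \<mu> (ball x (\<tau> * r))))"


section \<open>Functions of bounded variation\<close>

definition locally_lipschitz_on :: "'a::metric_space set \<Rightarrow> ('a \<Rightarrow> real) \<Rightarrow> bool" where
  "locally_lipschitz_on \<Omega> u \<longleftrightarrow>
     (\<forall>x\<in>\<Omega>. \<exists>r>0. \<exists>L. lipschitz_on L (ball x r \<inter> \<Omega>) u)"

definition L1loc_converges ::
    "('a::metric_space set \<Rightarrow> ennreal) \<Rightarrow> 'a set \<Rightarrow> (nat \<Rightarrow> 'a \<Rightarrow> real) \<Rightarrow> ('a \<Rightarrow> real) \<Rightarrow> bool" where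
  "L1loc_converges \<mu> \<Omega> v u \<longleftrightarrow>
     (\<forall>K. compact K \<and> K \<subseteq> \<Omega> \<longrightarrow>
        (\<lambda>i. \<integral>\<^sup>+x\<in>K. ennreal \<bar>v i x - u x\<bar> \<partial>outer_to_measure \<mu>) \<longlonglongrightarrow> 0)"

definition total_variation ::
    "('a::metric_space set \<Rightarrow> ennreal) \<Rightarrow> 'a set \<Rightarrow> ('a \<Rightarrow> real) \<Rightarrow> ennreal" where
  "total_variation \<mu> \<Omega> u =
     (INF (v, g) \<in> {(v :: nat \<Rightarrow> 'a \<Rightarrow> real, g :: nat \<Rightarrow> 'a \<Rightarrow> ennreal).
          (\<forall>i. locally_lipschitz_on \<Omega> (v i) \<and> upper_gradient \<Omega> (\<lambda>x. ereal (v i x)) (g i)) \<and>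
          L1loc_converges \<mu> \<Omega> v u}.
        liminf (\<lambda>i. \<integral>\<^sup>+x\<in>\<Omega>. g i x \<partial>outer_to_measure \<mu>))"

definition BV :: "('a::metric_space set \<Rightarrow> ennreal) \<Rightarrow> 'a set \<Rightarrow> ('a \<Rightarrow> real) set" where
  "BV \<mu> \<Omega> = {u. set_integrable (outer_to_measure \<mu>) \<Omega> u \<and> total_variation \<mu> \<Omega> u < \<infinity>}"


section \<open>Relative BV-capacities\<close>

definition cap_test_functions ::
    "('a::metric_space set \<Rightarrow> ennreal) \<Rightarrow> 'a set \<Rightarrow> 'a set \<Rightarrow> ('a \<Rightarrow> real) set" where
  "cap_test_functions \<mu> E B =
     {u \<in> BV \<mu> B.
        (\<exists>U. open U \<and> E \<subseteq> U \<and> U \<subseteq> B \<and> (\<forall>x\<in>U. u x = 1)) \<and>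
        compact (closure {x \<in> B. u x \<noteq> 0}) \<and> closure {x \<in> B. u x \<noteq> 0} \<subseteq> B}"

definition cap_BV_O :: "('a::metric_space set \<Rightarrow> ennreal) \<Rightarrow> 'a set \<Rightarrow> 'a set \<Rightarrow> ennreal" where
  "cap_BV_O \<mu> E B = (INF u \<in> cap_test_functions \<mu> E B. total_variation \<mu> B u)"

definition Cap_BV_O :: "('a::metric_space set \<Rightarrow> ennreal) \<Rightarrow> 'a set \<Rightarrow> 'a set \<Rightarrow> ennreal" where
  "Cap_BV_O \<mu> E B =
     (INF u \<in> cap_test_functions \<mu> E B.
        (\<integral>\<^sup>+x\<in>B. ennreal \<bar>u x\<bar> \<partial>outer_to_measure \<mu>) + total_variation \<mu> B u)"

definition comparable_with :: "real \<Rightarrow> ennreal \<Rightarrow> ennreal \<Rightarrow> bool" where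
  "comparable_with C a b \<longleftrightarrow> ennreal (inverse C) * a \<le> b \<and> b \<le> ennreal C * a"

end

theory Submission
  imports Defs
begin

text \<open>
  Since \<open>cap \<le> Cap\<close> is trivial, everything rests on a Poincare inequality
  \<open>\<integral>\<^sub>B \<bar>u\<bar> \<le> c \<parallel>Du\<parallel>(B)\<close> for functions \<open>u\<close> with compact support \<open>K\<close> in \<open>B\<close>.
  Approximating locally Lipschitz functions \<open>v\<^sub>i\<close> are multiplied by a Lipschitz cutoff that is \<open>1\<close>
  near \<open>K\<close>; the Leibniz rule for upper gradients costs only the term \<open>\<bar>v\<^sub>i\<bar> / \<rho>\<close> on a compact shell
  disjoint from \<open>K\<close>, whose integral tends to \<open>0\<close> because \<open>u\<close> vanishes there. The products extend by
  zero to \<open>X\<close> and vanish on a ball in the exterior of \<open>B\<close>, so the Poincare inequality on a large ball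
  controls their mean value, by doubling, and hence their integral.
\<close>

section \<open>Length of curves and arc-length parametrization\<close>

text \<open>The constant may depend on the ball but not on \<open>u\<close>, while the cutoff width
  \<open>\<rho>\<close> is dictated by the support of \<open>u\<close>. This is harmless, since
  \<open>1 / \<rho>\<close> only ever multiplies an L1 error on a compact set, and that error
  vanishes in the limit for each fixed \<open>u\<close>. The obstacle behind the cutoff is that the
  approximating functions live on \<open>B\<close> alone and need not have compact support there,
  whereas the Poincare inequality speaks of functions on all of X. Convergence is tested on compact
  sets only, so closed balls are first shown to be compact, from completeness and doubling. The
  Leibniz rule is proved by finite differences on short subarcs and uniform continuity, without
  differentiating along curves. It uses the upper gradient inequality on subarcs, although the
  definition tests whole paths only; this is why the development starts with lengths and subpaths.
  The nonempty exterior of \<open>B\<close> supplies a zero ball whose centre and radius are the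
  same for all \<open>u\<close>.\<close>

lemma sum_le_curve_length:
  assumes "mono_on {..n} p" "p ` {..n} \<subseteq> {a..b}"
  shows "(\<Sum>i<n. ennreal (dist (\<gamma> (p i)) (\<gamma> (p (Suc i))))) \<le> curve_length \<gamma> a b"
  unfolding curve_length_def by (rule SUP_upper2[of "(n, p)"]) (use assms in auto)

lemma curve_length_leI:
  assumes "\<And>n p. \<lbrakk>mono_on {..n} p; p ` {..n} \<subseteq> {a..b}\<rbrakk> \<Longrightarrow>
    (\<Sum>i<n. ennreal (dist (\<gamma> (p i)) (\<gamma> (p (Suc i))))) \<le> c"
  shows "curve_length \<gamma> a b \<le> c"
  unfolding curve_length_def by (rule SUP_least) (use assms in auto)

lemma curve_length_mono:
  assumes "c \<le> a" "b \<le> d"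
  shows "curve_length \<gamma> a b \<le> curve_length \<gamma> c d"
proof (rule curve_length_leI)
  fix n :: nat and p assume p: "mono_on {..n} p" "p ` {..n} \<subseteq> {a..b}"
  have "p ` {..n} \<subseteq> {c..d}" using p(2) assms by force
  then show "(\<Sum>i<n. ennreal (dist (\<gamma> (p i)) (\<gamma> (p (Suc i))))) \<le> curve_length \<gamma> c d"
    by (rule sum_le_curve_length[OF p(1)])
qed

lemma dist_le_curve_length:
  assumes "a \<le> b"
  shows "ennreal (dist (\<gamma> a) (\<gamma> b)) \<le> curve_length \<gamma> a b"
proof -
  have "mono_on {..1} (\<lambda>i::nat. if i = 0 then a else b)"
    using assms by (auto intro!: mono_onI)
  moreover have "(\<lambda>i::nat. if i = 0 then a else b) ` {..1} \<subseteq> {a..b}"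
    using assms by auto
  ultimately show ?thesis using sum_le_curve_length[of 1 "\<lambda>i. if i = 0 then a else b" a b \<gamma>] by simp
qed

lemma curve_length_add:
  assumes "a \<le> b" "b \<le> c"
  shows "curve_length \<gamma> a c = curve_length \<gamma> a b + curve_length \<gamma> b c"
proof (rule antisym)
  show "curve_length \<gamma> a c \<le> curve_length \<gamma> a b + curve_length \<gamma> b c"
  proof (rule curve_length_leI)
    fix n :: nat and p assume p: "mono_on {..n} p" "p ` {..n} \<subseteq> {a..c}"
    \<comment> \<open>Truncating at \<open>b\<close> from both sides splits the partition without
      inserting \<open>b\<close>: a link that straddles \<open>b\<close> yields one link ending at
      \<open>b\<close> in \<open>?q\<close> and one starting at \<open>b\<close> in
      \<open>?r\<close>, so the triangle inequality suffices.\<close>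
    let ?q = "\<lambda>i. min (p i) b" and ?r = "\<lambda>i. max (p i) b"
    have "dist (\<gamma> (p i)) (\<gamma> (p (Suc i)))
        \<le> dist (\<gamma> (?q i)) (\<gamma> (?q (Suc i))) + dist (\<gamma> (?r i)) (\<gamma> (?r (Suc i)))" if "i < n" for i
    proof -
      have "p i \<le> p (Suc i)" using p(1) that by (auto simp: mono_on_def)
      then show ?thesis by (auto simp: min_def max_def intro: dist_triangle)
    qed
    then have "(\<Sum>i<n. ennreal (dist (\<gamma> (p i)) (\<gamma> (p (Suc i)))))
       \<le> (\<Sum>i<n. ennreal (dist (\<gamma> (?q i)) (\<gamma> (?q (Suc i))))) +
         (\<Sum>i<n. ennreal (dist (\<gamma> (?r i)) (\<gamma> (?r (Suc i)))))"
      unfolding sum.distrib[symmetric]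
      by (intro sum_mono) (auto simp: ennreal_plus[symmetric] simp del: ennreal_plus intro!: ennreal_leI)
    also have "\<dots> \<le> curve_length \<gamma> a b + curve_length \<gamma> b c"
    proof (intro add_mono sum_le_curve_length)
      show "mono_on {..n} ?q" "mono_on {..n} ?r"
        using p(1) by (auto simp: mono_on_def intro: min.coboundedI1 max.coboundedI1)
      show "?q ` {..n} \<subseteq> {a..b}" "?r ` {..n} \<subseteq> {b..c}"
        using p(2) assms by (auto simp: image_subset_iff)
    qed
    finally show "(\<Sum>i<n. ennreal (dist (\<gamma> (p i)) (\<gamma> (p (Suc i)))))
        \<le> curve_length \<gamma> a b + curve_length \<gamma> b c" .
  qed
next
  have concat: "(\<Sum>i<n. ennreal (dist (\<gamma> (p i)) (\<gamma> (p (Suc i))))) +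
      (\<Sum>i<m. ennreal (dist (\<gamma> (q i)) (\<gamma> (q (Suc i))))) \<le> curve_length \<gamma> a c"
    if p: "mono_on {..n} p" "p ` {..n} \<subseteq> {a..b}" and q: "mono_on {..m} q" "q ` {..m} \<subseteq> {b..c}"
    for n m :: nat and p q
  proof -
    \<comment> \<open>Both partitions are kept in full: index \<open>n\<close> carries
      \<open>p n\<close> and index \<open>n + 1\<close> carries \<open>q 0\<close>. The link joining
      them has no counterpart on the left and is dropped as a nonnegative summand.\<close>
    define r where "r i = (if i \<le> n then p i else q (i - Suc n))" for i
    let ?d = "\<lambda>i. ennreal (dist (\<gamma> (r i)) (\<gamma> (r (Suc i))))"
    have "mono_on {..Suc (n + m)} r"
    proof (rule mono_onI)
      fix i j assume ij: "i \<in> {..Suc (n + m)}" "j \<in> {..Suc (n + m)}" "i \<le> j"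
      consider "j \<le> n" | "i \<le> n" "n < j" | "n < i" using ij by linarith
      then show "r i \<le> r j"
      proof cases
        case 1
        then show ?thesis using p(1) ij by (auto simp: r_def mono_on_def)
      next
        case 2
        then have "p i \<le> b" "b \<le> q (j - Suc n)"
          using p(2) q(2) ij by (auto simp: image_subset_iff)
        then show ?thesis using 2 by (auto simp: r_def)
      next
        case 3
        then have "i - Suc n \<in> {..m}" "j - Suc n \<in> {..m}" "i - Suc n \<le> j - Suc n" using ij by auto
        then show ?thesis using 3 ij mono_onD[OF q(1)] by (simp add: r_def)
      qed
    qed
    moreover have "r ` {..Suc (n + m)} \<subseteq> {a..c}"
    proof -
      have "r i \<in> {a..c}" if "i \<le> Suc (n + m)" for i
      proof (cases "i \<le> n")
        case True
        then have "p i \<in> {a..b}" using p(2) by auto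
        then show ?thesis using True assms by (auto simp: r_def)
      next
        case False
        then have "q (i - Suc n) \<in> {b..c}" using q(2) that by (auto simp: image_subset_iff)
        then show ?thesis using False assms by (auto simp: r_def)
      qed
      then show ?thesis by auto
    qed
    ultimately have "(\<Sum>i<Suc (n + m). ?d i) \<le> curve_length \<gamma> a c"
      by (rule sum_le_curve_length)
    moreover have "(\<Sum>i<n. ?d i) + (\<Sum>i<m. ?d (Suc n + i)) \<le> (\<Sum>i<Suc (n + m). ?d i)"
    proof -
      have "(\<Sum>i<Suc n + m. ?d i) = (\<Sum>i<Suc n. ?d i) + (\<Sum>i<m. ?d (Suc n + i))"
        by (induction m) (simp_all add: add.assoc)
      then show ?thesis by (simp add: add_right_mono)
    qed
    moreover have "(\<Sum>i<n. ?d i) = (\<Sum>i<n. ennreal (dist (\<gamma> (p i)) (\<gamma> (p (Suc i)))))"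
      by (rule sum.cong) (auto simp: r_def)
    moreover have "(\<Sum>i<m. ?d (Suc n + i)) = (\<Sum>i<m. ennreal (dist (\<gamma> (q i)) (\<gamma> (q (Suc i)))))"
      by (rule sum.cong) (auto simp: r_def Suc_diff_le)
    ultimately show ?thesis by simp
  qed
  have ne: "{(n :: nat, p :: nat \<Rightarrow> real). mono_on {..n} p \<and> p ` {..n} \<subseteq> {u..v}} \<noteq> {}"
    if "u \<le> v" for u v :: real
  proof -
    have "(0, \<lambda>_. u) \<in> {(n :: nat, p :: nat \<Rightarrow> real). mono_on {..n} p \<and> p ` {..n} \<subseteq> {u..v}}"
      using that by (auto simp: mono_on_def)
    then show ?thesis by blast
  qed
  have left: "curve_length \<gamma> a b + (\<Sum>i<m. ennreal (dist (\<gamma> (q i)) (\<gamma> (q (Suc i))))) \<le> curve_length \<gamma> a c"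
    if q: "mono_on {..m} q" "q ` {..m} \<subseteq> {b..c}" for m q
    unfolding curve_length_def[of \<gamma> a b]
    by (subst ennreal_SUP_add_left[symmetric, OF ne[OF assms(1)]]) (use concat q in \<open>auto intro!: SUP_least\<close>)
  show "curve_length \<gamma> a b + curve_length \<gamma> b c \<le> curve_length \<gamma> a c"
    unfolding curve_length_def[of \<gamma> b c]
    by (subst ennreal_SUP_add_right[OF ne[OF assms(2)]])
       (use left in \<open>auto intro!: SUP_least\<close>)
qed

lemma curve_length_affine:
  assumes "0 \<le> m" "0 \<le> t"
  shows "curve_length (\<lambda>s. \<gamma> (m * s + d)) 0 t = curve_length \<gamma> d (m * t + d)"
proof (rule antisym; rule curve_length_leI)
  fix n :: nat and p assume p: "mono_on {..n} p" "p ` {..n} \<subseteq> {0..t}"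
  show "(\<Sum>i<n. ennreal (dist (\<gamma> (m * p i + d)) (\<gamma> (m * p (Suc i) + d))))
      \<le> curve_length \<gamma> d (m * t + d)"
    using assms p
    by (intro sum_le_curve_length[of n "\<lambda>i. m * p i + d"])
       (auto simp: mono_on_def image_subset_iff intro: mult_left_mono)
next
  fix n :: nat and p assume p: "mono_on {..n} p" "p ` {..n} \<subseteq> {d..m * t + d}"
  show "(\<Sum>i<n. ennreal (dist (\<gamma> (p i)) (\<gamma> (p (Suc i)))))
      \<le> curve_length (\<lambda>s. \<gamma> (m * s + d)) 0 t"
  proof (cases "m = 0")
    case True
    then have "p i = d" if "i \<le> n" for i
      using p(2) that by (force simp: image_subset_iff)
    then show ?thesis by (simp add: Suc_le_eq)
  next
    case False
    with assms have "0 < m" by simp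
    have "mono_on {..n} (\<lambda>i. (p i - d) / m)"
      using p(1) \<open>0 < m\<close> by (auto simp: mono_on_def divide_right_mono)
    moreover have "(\<lambda>i. (p i - d) / m) ` {..n} \<subseteq> {0..t}"
      using p(2) \<open>0 < m\<close> by (auto simp: image_subset_iff divide_simps mult.commute diff_le_eq)
    ultimately show ?thesis
      using sum_le_curve_length[of n "\<lambda>i. (p i - d) / m" 0 t "\<lambda>s. \<gamma> (m * s + d)"] \<open>0 < m\<close>
      by simp
  qed
qed

text \<open>For a fixed partition, truncated at \<open>s\<close>, the polygonal sum is continuous in
  \<open>s\<close>. A bound on all shorter initial arcs therefore passes to each sum at
  \<open>t\<close>, and then to their supremum.\<close>

lemma curve_length_left_lsc:
  assumes "continuous_on {a..t} \<gamma>" "a < t" "\<And>t'. a < t' \<Longrightarrow> t' < t \<Longrightarrow> curve_length \<gamma> a t' \<le> c"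
  shows "curve_length \<gamma> a t \<le> c"
proof (cases c)
  case (real C)
  show ?thesis
  proof (rule curve_length_leI)
    fix n :: nat and p assume p: "mono_on {..n} p" "p ` {..n} \<subseteq> {a..t}"
    define F where "F s = (\<Sum>i<n. dist (\<gamma> (min (p i) s)) (\<gamma> (min (p (Suc i)) s)))" for s
    have "continuous_on (closure {a<..<t}) F"
      unfolding F_def using assms(2) p(2)
      by (auto intro!: continuous_intros continuous_on_compose2[OF assms(1)] simp: image_subset_iff)
    moreover have "F s \<le> C" if "s \<in> {a<..<t}" for s
    proof -
      have "ennreal (F s) \<le> curve_length \<gamma> a s"
        unfolding F_def using p that
        by (subst sum_ennreal[symmetric], simp, intro sum_le_curve_length)
           (auto simp: mono_on_def image_subset_iff min_le_iff_disj)
      also have "\<dots> \<le> ennreal C" using assms(3)[of s] that real by auto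
      finally show ?thesis using real by simp
    qed
    ultimately have "F t \<le> C" using continuous_le_on_closure[of "{a<..<t}" F t C] assms(2) by auto
    moreover have "F t = (\<Sum>i<n. dist (\<gamma> (p i)) (\<gamma> (p (Suc i))))"
      unfolding F_def using p(2) by (intro sum.cong) (auto simp: image_subset_iff)
    ultimately show "(\<Sum>i<n. ennreal (dist (\<gamma> (p i)) (\<gamma> (p (Suc i))))) \<le> c"
      using real by (simp add: sum_ennreal ennreal_leI)
  qed
qed simp

lemma curve_length_right_lsc:
  assumes "continuous_on {t..b} \<gamma>" "t < b" "\<And>t'. t < t' \<Longrightarrow> t' < b \<Longrightarrow> curve_length \<gamma> t' b \<le> c"
  shows "curve_length \<gamma> t b \<le> c"
proof (cases c)
  case (real C)
  show ?thesis
  proof (rule curve_length_leI)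
    fix n :: nat and p assume p: "mono_on {..n} p" "p ` {..n} \<subseteq> {t..b}"
    define F where "F s = (\<Sum>i<n. dist (\<gamma> (max (p i) s)) (\<gamma> (max (p (Suc i)) s)))" for s
    have "continuous_on (closure {t<..<b}) F"
      unfolding F_def using assms(2) p(2)
      by (auto intro!: continuous_intros continuous_on_compose2[OF assms(1)] simp: image_subset_iff)
    moreover have "F s \<le> C" if "s \<in> {t<..<b}" for s
    proof -
      have "ennreal (F s) \<le> curve_length \<gamma> s b"
        unfolding F_def using p that
        by (subst sum_ennreal[symmetric], simp, intro sum_le_curve_length)
           (auto simp: mono_on_def image_subset_iff intro: max.coboundedI1)
      also have "\<dots> \<le> ennreal C" using assms(3)[of s] that real by auto
      finally show ?thesis using real by simp
    qed
    ultimately have "F t \<le> C" using continuous_le_on_closure[of "{t<..<b}" F t C] assms(2) by auto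
    moreover have "F t = (\<Sum>i<n. dist (\<gamma> (p i)) (\<gamma> (p (Suc i))))"
      unfolding F_def using p(2) by (intro sum.cong) (auto simp: image_subset_iff max_absorb1)
    ultimately show "(\<Sum>i<n. ennreal (dist (\<gamma> (p i)) (\<gamma> (p (Suc i))))) \<le> c"
      using real by (simp add: sum_ennreal ennreal_leI)
  qed
qed simp

lemma curve_length_refl [simp]: "curve_length \<gamma> a a = 0"
proof -
  have "curve_length \<gamma> a a \<le> 0"
  proof (rule curve_length_leI)
    fix n :: nat and p assume "mono_on {..n} p" "p ` {..n} \<subseteq> {a..a}"
    then have "p i = a" if "i \<le> n" for i using that by auto
    then show "(\<Sum>i<n. ennreal (dist (\<gamma> (p i)) (\<gamma> (p (Suc i))))) \<le> 0" by (simp add: Suc_le_eq)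
  qed
  then show ?thesis by simp
qed

section \<open>Arc-length parametrization of rectifiable paths\<close>

definition arclength :: "(real \<Rightarrow> 'a::metric_space) \<Rightarrow> real \<Rightarrow> real" where
  "arclength \<gamma> t = enn2real (curve_length \<gamma> 0 t)"

lemma arclength_0 [simp]: "arclength \<gamma> 0 = 0"
  by (simp add: arclength_def)

lemma arclength_nonneg [simp]: "0 \<le> arclength \<gamma> t"
  by (simp add: arclength_def)

context
  fixes \<gamma> :: "real \<Rightarrow> 'a::metric_space" and \<Omega>
  assumes \<gamma>: "\<gamma> \<in> rect_paths \<Omega>"
begin

text \<open>Rectifiability enters here: \<open>enn2real\<close> would turn an infinite length into
  0.\<close>

lemma curve_length_0_eq:
  assumes "t \<le> 1"
  shows "curve_length \<gamma> 0 t = ennreal (arclength \<gamma> t)"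
proof -
  have "curve_length \<gamma> 0 t \<le> curve_length \<gamma> 0 1" using assms by (intro curve_length_mono) auto
  also have "\<dots> < \<infinity>" using \<gamma> by (simp add: rect_paths_def)
  finally show ?thesis by (simp add: arclength_def)
qed

lemma arclength_mono:
  assumes "s \<le> t" "t \<le> 1"
  shows "arclength \<gamma> s \<le> arclength \<gamma> t"
proof -
  have "ennreal (arclength \<gamma> s) \<le> ennreal (arclength \<gamma> t)"
    using curve_length_mono[of 0 0 s t \<gamma>] assms by (simp add: curve_length_0_eq)
  then show ?thesis by simp
qed

lemma curve_length_eq:
  assumes "0 \<le> s" "s \<le> t" "t \<le> 1"
  shows "curve_length \<gamma> s t = ennreal (arclength \<gamma> t - arclength \<gamma> s)"
proof -
  have "ennreal (arclength \<gamma> t) = ennreal (arclength \<gamma> s) + curve_length \<gamma> s t"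
    using curve_length_add[of 0 s t \<gamma>] assms by (simp add: curve_length_0_eq)
  then show ?thesis
    by (cases "curve_length \<gamma> s t") (auto simp: ennreal_plus[symmetric] simp del: ennreal_plus)
qed

lemma dist_le_arclength:
  assumes "s \<in> {0..1}" "t \<in> {0..1}"
  shows "dist (\<gamma> s) (\<gamma> t) \<le> \<bar>arclength \<gamma> s - arclength \<gamma> t\<bar>"
proof -
  have *: "dist (\<gamma> s) (\<gamma> t) \<le> arclength \<gamma> t - arclength \<gamma> s"
    if "0 \<le> s" "s \<le> t" "t \<le> 1" for s t
    using dist_le_curve_length[of s t \<gamma>] that arclength_mono[of s t] by (simp add: curve_length_eq)
  show ?thesis
    using *[of s t] *[of t s] assms by (cases "s \<le> t") (auto simp: dist_commute)
qed

text \<open>An intermediate value argument that uses only the two semicontinuity lemmas. At the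
  supremum \<open>T\<close> of the parameters with arc length at most \<open>s\<close>, approach
  from the left gives arc length at most \<open>s\<close>. Parameters beyond \<open>T\<close> exceed
  \<open>s\<close>, so by additivity the remaining length is at most the total minus
  \<open>s\<close>; approach from the right carries this bound to \<open>T\<close>.\<close>

lemma arclength_surj:
  assumes "0 \<le> s" "s \<le> arclength \<gamma> 1"
  obtains t where "t \<in> {0..1}" "arclength \<gamma> t = s"
proof -
  let ?A = "{t \<in> {0..1}. arclength \<gamma> t \<le> s}"
  define T where "T = Sup ?A"
  have cont: "continuous_on {0..1} \<gamma>" using \<gamma> by (simp add: rect_paths_def path_def)
  have 0: "0 \<in> ?A" using assms by simp
  have bdd: "bdd_above ?A" by (rule bdd_aboveI[of _ 1]) auto
  have T: "0 \<le> T" "T \<le> 1"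
    unfolding T_def by (rule cSup_upper[OF 0 bdd], rule cSup_least) (use 0 in blast, auto)
  have "arclength \<gamma> T \<le> s"
  proof (cases "T = 0")
    case False
    have "curve_length \<gamma> 0 T \<le> ennreal s"
    proof (rule curve_length_left_lsc)
      show "continuous_on {0..T} \<gamma>" using T by (intro continuous_on_subset[OF cont]) auto
      fix t assume t: "0 < t" "t < T"
      then obtain t' where "t' \<in> ?A" "t < t'"
        using less_cSup_iff[of ?A t] 0 bdd unfolding T_def by blast
      with t T show "curve_length \<gamma> 0 t \<le> ennreal s"
        using arclength_mono[of t t'] by (auto simp: curve_length_0_eq intro!: ennreal_leI)
    qed (use T False in auto)
    then show ?thesis using T assms by (simp add: curve_length_0_eq)
  qed (use assms in simp)
  moreover have "s \<le> arclength \<gamma> T"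
  proof (cases "T = 1")
    case False
    have "curve_length \<gamma> T 1 \<le> ennreal (arclength \<gamma> 1 - s)"
    proof (rule curve_length_right_lsc)
      show "continuous_on {T..1} \<gamma>" using T by (intro continuous_on_subset[OF cont]) auto
      fix t assume t: "T < t" "t < 1"
      then have "t \<notin> ?A" using cSup_upper[OF _ bdd] unfolding T_def by fastforce
      with t T show "curve_length \<gamma> t 1 \<le> ennreal (arclength \<gamma> 1 - s)"
        by (auto simp: curve_length_eq intro!: ennreal_leI)
    qed (use T False in auto)
    then show ?thesis using T assms by (simp add: curve_length_eq)
  qed (use assms in simp)
  ultimately show ?thesis using that[of T] T by auto
qed

text \<open>The chosen parameter has the same arc length as \<open>t\<close>, and parameters of
  equal arc length are mapped to points at distance 0.\<close>

lemma arclength_param_arclength: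
  assumes "t \<in> {0..1}"
  shows "arclength_param \<gamma> (arclength \<gamma> t) = \<gamma> t"
proof -
  define t' where "t' = (SOME t'. t' \<in> {0..1} \<and> curve_length \<gamma> 0 t' = ennreal (arclength \<gamma> t))"
  have "t' \<in> {0..1} \<and> curve_length \<gamma> 0 t' = ennreal (arclength \<gamma> t)"
    unfolding t'_def by (rule someI[of _ t]) (use assms in \<open>simp add: curve_length_0_eq\<close>)
  then have "t' \<in> {0..1}" "arclength \<gamma> t' = arclength \<gamma> t" by (auto simp: curve_length_0_eq)
  then have "\<gamma> t' = \<gamma> t" using dist_le_arclength[of t' t] assms by simp
  then show ?thesis by (simp add: arclength_param_def t'_def)
qed

lemma dist_arclength_param_le:
  assumes "s \<in> {0..arclength \<gamma> 1}" "t \<in> {0..arclength \<gamma> 1}"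
  shows "dist (arclength_param \<gamma> s) (arclength_param \<gamma> t) \<le> \<bar>s - t\<bar>"
proof -
  obtain s' t' where "s' \<in> {0..1}" "s = arclength \<gamma> s'" "t' \<in> {0..1}" "t = arclength \<gamma> t'"
    using assms by (metis arclength_surj atLeastAtMost_iff)
  then show ?thesis by (simp add: arclength_param_arclength dist_le_arclength)
qed

lemma continuous_on_arclength_param: "continuous_on {0..arclength \<gamma> 1} (arclength_param \<gamma>)"
  by (rule lipschitz_on_continuous_on[of 1])
     (auto intro!: lipschitz_onI simp: dist_arclength_param_le dist_real_def)

lemma arclength_param_0: "arclength_param \<gamma> 0 = pathstart \<gamma>"
  using arclength_param_arclength[of 0] by (simp add: pathstart_def)

lemma arclength_param_end: "arclength_param \<gamma> (arclength \<gamma> 1) = pathfinish \<gamma>"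
  using arclength_param_arclength[of 1] by (simp add: pathfinish_def)

lemma line_integral_eq:
  "line_integral g \<gamma> = (\<integral>\<^sup>+s\<in>{0..arclength \<gamma> 1}. g (arclength_param \<gamma> s) \<partial>lebesgue)"
  by (simp add: line_integral_def arclength_def)

end

text \<open>Upper gradients are tested on whole paths inside a set. This lemma turns an arc of a
  path that may leave \<open>\<Omega>'\<close> into a path within \<open>\<Omega>'\<close> whose
  arc-length parametrization is merely shifted. Distinct end points guarantee that it is not
  constant.\<close>

lemma subpath_arclength:
  assumes \<gamma>: "\<gamma> \<in> rect_paths \<Omega>"
    and "0 \<le> a" "a \<le> b" "b \<le> arclength \<gamma> 1"
    and "arclength_param \<gamma> a \<noteq> arclength_param \<gamma> b"
    and "arclength_param \<gamma> ` {a..b} \<subseteq> \<Omega>'"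
  obtains \<sigma> where "\<sigma> \<in> rect_paths \<Omega>'" "arclength \<sigma> 1 = b - a"
    "pathstart \<sigma> = arclength_param \<gamma> a" "pathfinish \<sigma> = arclength_param \<gamma> b"
    "\<forall>s\<in>{0..b - a}. arclength_param \<sigma> s = arclength_param \<gamma> (a + s)"
proof -
  obtain ta tb where t: "ta \<in> {0..1}" "tb \<in> {0..1}" "arclength \<gamma> ta = a" "arclength \<gamma> tb = b"
    using assms(2-4) by (metis arclength_surj[OF \<gamma>] order_trans)
  have "ta \<noteq> tb" using assms(5) t by auto
  with t assms(3) arclength_mono[OF \<gamma>, of tb ta] assms(5) have "ta < tb" by (smt (verit) atLeastAtMost_iff)
  let ?f = "\<lambda>x. (tb - ta) * x + ta"
  define \<sigma> where \<sigma>: "\<sigma> = (\<lambda>x. \<gamma> (?f x))"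
  have f: "ta \<le> ?f x" "?f x \<le> tb" if "x \<in> {0..1}" for x
  proof -
    show "ta \<le> ?f x" using that \<open>ta < tb\<close> by simp
    have "(tb - ta) * x \<le> tb - ta" using that \<open>ta < tb\<close> by (intro mult_left_le) auto
    then show "?f x \<le> tb" by linarith
  qed
  have len: "curve_length \<sigma> 0 x = ennreal (arclength \<gamma> (?f x) - a)" if "x \<in> {0..1}" for x
    using that \<open>ta < tb\<close> t f[OF that] by (simp add: \<sigma> curve_length_affine curve_length_eq[OF \<gamma>])
  have arc: "arclength \<sigma> x = arclength \<gamma> (?f x) - a" if "x \<in> {0..1}" for x
    using len[OF that] f[OF that] t arclength_mono[OF \<gamma>, of ta "?f x"] by (simp add: arclength_def)
  have ends: "pathstart \<sigma> = arclength_param \<gamma> a" "pathfinish \<sigma> = arclength_param \<gamma> b"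
    using t arclength_param_arclength[OF \<gamma>] by (auto simp: \<sigma> pathstart_def pathfinish_def)
  have \<sigma>_in: "\<sigma> \<in> rect_paths \<Omega>'"
    unfolding rect_paths_def
  proof (intro CollectI conjI)
    have "continuous_on {0..1} \<gamma>" using \<gamma> by (simp add: rect_paths_def path_def)
    then show "path \<sigma>"
      unfolding \<sigma> path_def
    proof (rule continuous_on_compose2)
      show "?f ` {0..1} \<subseteq> {0..1}" using f t by (meson atLeastAtMost_iff image_subsetI order_trans)
    qed (intro continuous_intros)
    show "path_image \<sigma> \<subseteq> \<Omega>'"
    proof (clarsimp simp: path_image_def)
      fix x :: real assume x: "0 \<le> x" "x \<le> 1"
      then have "\<sigma> x = arclength_param \<gamma> (arclength \<gamma> (?f x))"
        using f[of x] t by (simp add: \<sigma> arclength_param_arclength[OF \<gamma>])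
      moreover have "arclength \<gamma> (?f x) \<in> {a..b}"
        using f[of x] t x arclength_mono[OF \<gamma>, of ta "?f x"] arclength_mono[OF \<gamma>, of "?f x" tb] by auto
      ultimately show "\<sigma> x \<in> \<Omega>'" using assms(6) by auto
    qed
    show "curve_length \<sigma> 0 1 < \<infinity>" using len[of 1] by simp
    show "\<not> \<sigma> constant_on {0..1}"
      using assms(5) ends unfolding constant_on_def pathstart_def pathfinish_def
      by (metis atLeastAtMost_iff order_refl zero_le_one)
  qed
  have "arclength_param \<sigma> s = arclength_param \<gamma> (a + s)" if "s \<in> {0..b - a}" for s
  proof -
    have "s \<in> {0..arclength \<sigma> 1}" using arc[of 1] t that by simp
    then obtain x where x: "x \<in> {0..1}" "arclength \<sigma> x = s"
      using arclength_surj[OF \<sigma>_in] by (metis atLeastAtMost_iff)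
    then have "arclength_param \<sigma> s = \<gamma> (?f x)"
      using arclength_param_arclength[OF \<sigma>_in, of x] by (simp add: \<sigma>)
    also have "\<dots> = arclength_param \<gamma> (arclength \<gamma> (?f x))"
      using f[of x] x t by (simp add: arclength_param_arclength[OF \<gamma>])
    finally show ?thesis using arc[of x] x by simp
  qed
  then show ?thesis using that[of \<sigma>] \<sigma>_in ends arc[of 1] t by simp
qed

section \<open>Upper gradients and the Leibniz rule for cutoffs\<close>

text \<open>The inequality for the subpath, with its line integral translated back to the parameter
  interval of the original path. Only the arc has to lie in \<open>B\<close>. If its end points
  coincide, the left side is 0.\<close>

lemma upper_gradient_arclength:
  fixes g :: "'a::metric_space \<Rightarrow> ennreal"
  assumes \<gamma>: "\<gamma> \<in> rect_paths \<Omega>" and B: "B \<in> sets borel"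
    and ug: "upper_gradient B (\<lambda>x. ereal (v x)) g"
    and ab: "0 \<le> a" "a \<le> b" "b \<le> arclength \<gamma> 1"
    and sub: "arclength_param \<gamma> ` {a..b} \<subseteq> B"
  shows "ennreal \<bar>v (arclength_param \<gamma> a) - v (arclength_param \<gamma> b)\<bar>
    \<le> (\<integral>\<^sup>+s\<in>{a..b}. g (arclength_param \<gamma> s) \<partial>lborel)"
proof (cases "arclength_param \<gamma> a = arclength_param \<gamma> b")
  case False
  let ?h = "arclength_param \<gamma>"
  obtain \<sigma> where \<sigma>: "\<sigma> \<in> rect_paths B" "arclength \<sigma> 1 = b - a"
    "pathstart \<sigma> = ?h a" "pathfinish \<sigma> = ?h b"
    "\<forall>s\<in>{0..b - a}. arclength_param \<sigma> s = ?h (a + s)"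
    by (rule subpath_arclength[OF \<gamma> ab False sub])
  define F where "F s = g (?h s) * indicator {a..b} s" for s
  have "(\<lambda>x. g x * indicator B x) \<in> borel_measurable borel"
    using ug B by (simp add: upper_gradient_def borel_measurable_restrict_space_iff_ennreal)
  moreover have "continuous_on {a..b} ?h"
    using continuous_on_arclength_param[OF \<gamma>] by (rule continuous_on_subset) (use ab in auto)
  then have "continuous_on UNIV (\<lambda>s. ?h (max a (min b s)))"
  proof (rule continuous_on_compose2)
    show "range (\<lambda>s. max a (min b s)) \<subseteq> {a..b}" using ab by auto
  qed (intro continuous_intros)
  then have "(\<lambda>s. ?h (max a (min b s))) \<in> borel_measurable borel"
    by (rule borel_measurable_continuous_onI)
  ultimately have [measurable]: "(\<lambda>s. g (?h (max a (min b s))) * indicator B (?h (max a (min b s))))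
      \<in> borel_measurable borel" by (rule measurable_compose[rotated])
  \<comment> \<open>\<open>g\<close> is Borel only on \<open>B\<close>, and the parametrization is
    controlled only on the range of arc lengths. Clamping the parameter and inserting the indicator
    of \<open>B\<close> exhibits \<open>F\<close> as a Borel function, so that integrals over
    \<open>lebesgue\<close> and \<open>lborel\<close> agree and translation applies.\<close>
  have "F s = g (?h (max a (min b s))) * indicator B (?h (max a (min b s))) * indicator {a..b} s" for s
  proof (cases "s \<in> {a..b}")
    case True
    then have "max a (min b s) = s" "?h s \<in> B" using sub by auto
    then show ?thesis by (simp add: F_def)
  qed (simp add: F_def)
  then have F: "F \<in> borel_measurable borel" by (simp add: fun_eq_iff[symmetric] cong: measurable_cong)
  have "line_integral g \<sigma> = (\<integral>\<^sup>+s\<in>{0..b - a}. g (arclength_param \<sigma> s) \<partial>lborel)"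
    by (simp add: line_integral_eq[OF \<sigma>(1)] \<sigma>(2) nn_integral_completion)
  also have "\<dots> = (\<integral>\<^sup>+s. F (a + 1 * s) \<partial>lborel)"
    by (rule nn_integral_cong) (auto simp: F_def \<sigma>(5) indicator_def)
  also have "\<dots> = (\<integral>\<^sup>+s. F s \<partial>lborel)"
    using nn_integral_real_affine[OF F, of 1 a] by simp
  finally have "line_integral g \<sigma> = (\<integral>\<^sup>+s. F s \<partial>lborel)" .
  moreover have "upper_gradient_ineq (\<lambda>x. ereal (v x)) g \<sigma>"
    using ug \<sigma>(1) by (simp add: upper_gradient_def)
  then have "ereal \<bar>v (?h a) - v (?h b)\<bar> \<le> enn2ereal (line_integral g \<sigma>)"
    by (simp add: upper_gradient_ineq_def \<sigma>)
  then have "ennreal \<bar>v (?h a) - v (?h b)\<bar> \<le> line_integral g \<sigma>"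
    by (simp add: ennreal.rep_eq less_eq_ennreal.rep_eq)
  ultimately show ?thesis by (simp add: F_def)
qed simp

lemma set_nn_integral_Icc_add:
  fixes H :: "real \<Rightarrow> ennreal"
  assumes [measurable]: "H \<in> borel_measurable borel" and "a \<le> b" "b \<le> c"
  shows "(\<integral>\<^sup>+s\<in>{a..c}. H s \<partial>lborel) = (\<integral>\<^sup>+s\<in>{a..b}. H s \<partial>lborel) + (\<integral>\<^sup>+s\<in>{b..c}. H s \<partial>lborel)"
proof -
  have "(\<integral>\<^sup>+s\<in>{a..b}. H s \<partial>lborel) + (\<integral>\<^sup>+s\<in>{b..c}. H s \<partial>lborel)
      = (\<integral>\<^sup>+s. H s * indicator {a..b} s + H s * indicator {b..c} s \<partial>lborel)"
    by (rule nn_integral_add[symmetric]) auto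
  also have "\<dots> = (\<integral>\<^sup>+s\<in>{a..c}. H s \<partial>lborel)"
  proof (rule nn_integral_cong_AE)
    have "H s * indicator {a..b} s + H s * indicator {b..c} s = H s * indicator {a..c} s" if "s \<noteq> b" for s
      using assms(2,3) that by (auto simp: indicator_def)
    then show "AE s in lborel. H s * indicator {a..b} s + H s * indicator {b..c} s = H s * indicator {a..c} s"
      by (rule eventually_mono[OF AE_lborel_singleton[of b]])
  qed
  finally show ?thesis ..
qed

text \<open>Short steps are chained: increments of \<open>f\<close> obey the triangle inequality,
  while the integral is additive over adjacent intervals. No regularity of \<open>f\<close>
  enters.\<close>

lemma local_to_global_estimate:
  fixes f :: "real \<Rightarrow> real" and H :: "real \<Rightarrow> ennreal"
  assumes [measurable]: "H \<in> borel_measurable borel" and "0 < \<delta>" "0 \<le> l"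
    and step: "\<And>a b. \<lbrakk>0 \<le> a; a \<le> b; b \<le> l; b - a \<le> \<delta>\<rbrakk> \<Longrightarrow>
      ennreal \<bar>f a - f b\<bar> \<le> (\<integral>\<^sup>+s\<in>{a..b}. H s \<partial>lborel)"
  shows "ennreal \<bar>f 0 - f l\<bar> \<le> (\<integral>\<^sup>+s\<in>{0..l}. H s \<partial>lborel)"
proof -
  have *: "ennreal \<bar>f 0 - f b\<bar> \<le> (\<integral>\<^sup>+s\<in>{0..b}. H s \<partial>lborel)"
    if "0 \<le> b" "b \<le> l" "b \<le> real k * \<delta>" for b k
    using that
  proof (induction k arbitrary: b)
    case 0
    then have "b = 0" by simp
    then show ?case by simp
  next
    case (Suc k)
    define a where "a = max 0 (b - \<delta>)"
    have a: "0 \<le> a" "a \<le> b" "a \<le> real k * \<delta>" "b - a \<le> \<delta>"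
      using Suc.prems \<open>0 < \<delta>\<close> by (auto simp: a_def distrib_right)
    have "ennreal \<bar>f 0 - f b\<bar> \<le> ennreal (\<bar>f 0 - f a\<bar> + \<bar>f a - f b\<bar>)"
      by (intro ennreal_leI) linarith
    also have "\<dots> = ennreal \<bar>f 0 - f a\<bar> + ennreal \<bar>f a - f b\<bar>"
      by (simp add: ennreal_plus)
    also have "\<dots> \<le> (\<integral>\<^sup>+s\<in>{0..a}. H s \<partial>lborel) + (\<integral>\<^sup>+s\<in>{a..b}. H s \<partial>lborel)"
      by (rule add_mono[OF Suc.IH step]) (use a Suc.prems in auto)
    also have "\<dots> = (\<integral>\<^sup>+s\<in>{0..b}. H s \<partial>lborel)"
      by (rule set_nn_integral_Icc_add[symmetric]) (use a in auto)
    finally show ?case .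
  qed
  obtain k where "l / \<delta> \<le> real k" using real_arch_simple by blast
  then have "l \<le> real k * \<delta>" using \<open>0 < \<delta>\<close> by (simp add: divide_simps)
  then show ?thesis using *[of l k] assms(3) by simp
qed

section \<open>Lipschitz cutoffs and the Leibniz rule\<close>

definition cutoff :: "'a::metric_space set \<Rightarrow> real \<Rightarrow> 'a \<Rightarrow> real" where
  "cutoff K \<rho> x = max 0 (min 1 (2 - infdist x K / \<rho>))"

lemma cutoff_range: "0 \<le> cutoff K \<rho> x" "cutoff K \<rho> x \<le> 1"
  by (auto simp: cutoff_def)

lemma cutoff_eq_1: "0 < \<rho> \<Longrightarrow> infdist x K \<le> \<rho> \<Longrightarrow> cutoff K \<rho> x = 1"
  by (simp add: cutoff_def divide_simps)

lemma cutoff_eq_0: "0 < \<rho> \<Longrightarrow> 2 * \<rho> \<le> infdist x K \<Longrightarrow> cutoff K \<rho> x = 0"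
  by (auto simp: cutoff_def divide_simps max_def min_def)

lemma continuous_on_cutoff: "continuous_on A (cutoff K \<rho>)"
  unfolding cutoff_def divide_inverse by (intro continuous_intros)

lemma cutoff_lipschitz:
  assumes "0 < \<rho>"
  shows "\<bar>cutoff K \<rho> x - cutoff K \<rho> y\<bar> \<le> dist x y / \<rho>"
proof -
  have "\<bar>cutoff K \<rho> x - cutoff K \<rho> y\<bar> \<le> \<bar>infdist x K / \<rho> - infdist y K / \<rho>\<bar>"
    unfolding cutoff_def by linarith
  also have "\<dots> = \<bar>infdist x K - infdist y K\<bar> / \<rho>"
    using assms by (simp add: diff_divide_distrib[symmetric])
  also have "\<dots> \<le> dist x y / \<rho>"
    using assms by (intro divide_right_mono infdist_triangle_abs) auto
  finally show ?thesis .
qed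

text \<open>
  The cutoff varies only for \<open>\<rho> \<le> infdist x K \<le> 2 * \<rho>\<close>; the margins ensure that a short subarc along
  which it varies lies entirely in the shell.
\<close>

definition cutoff_shell :: "'a::metric_space set \<Rightarrow> real \<Rightarrow> 'a set" where
  "cutoff_shell K \<rho> = {x. \<rho> / 2 \<le> infdist x K \<and> infdist x K \<le> 3 * \<rho>}"

lemma closed_cutoff_shell: "closed (cutoff_shell K \<rho>)"
  unfolding cutoff_shell_def
  by (intro closed_Collect_conj closed_Collect_le continuous_intros)

lemma borel_measurable_times_indicator:
  fixes v :: "'a::topological_space \<Rightarrow> real"
  assumes "S \<in> sets borel" "continuous_on S v"
  shows "(\<lambda>x. v x * indicator S x) \<in> borel_measurable borel"
  using borel_measurable_continuous_on_indicator[OF assms] by (simp add: mult.commute)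

text \<open>A discrete product rule on short arcs: the increment of the product is at most the
  increment of \<open>v\<close> plus \<open>\<bar>v\<bar>\<close> at one end point times the
  increment of the cutoff. The first term is governed by \<open>g\<close>, the second by the
  Lipschitz constant \<open>1 / \<rho>\<close>. Freezing \<open>v\<close> at an end point costs an
  arbitrarily small error.\<close>

lemma upper_gradient_cutoff_mult:
  fixes v :: "'a::metric_space \<Rightarrow> real"
  assumes B: "open B" and ug: "upper_gradient B (\<lambda>x. ereal (v x)) g"
    and v: "continuous_on B v" and \<rho>: "0 < \<rho>"
    and cpt: "compact {x. infdist x K \<le> 3 * \<rho>}" and sub: "{x. infdist x K \<le> 3 * \<rho>} \<subseteq> B"
  shows "upper_gradient UNIV (\<lambda>x. ereal (cutoff K \<rho> x * v x))
    (\<lambda>x. g x * indicator B x + ennreal (\<bar>v x\<bar> / \<rho>) * indicator (cutoff_shell K \<rho>) x)"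
    (is "upper_gradient UNIV (\<lambda>x. ereal (?w x)) ?G")
proof -
  let ?S = "cutoff_shell K \<rho>" and ?N = "{x. infdist x K \<le> 3 * \<rho>}"
  have "?S \<subseteq> B" using sub by (auto simp: cutoff_shell_def)
  have S: "?S \<in> sets borel" by (rule borel_closed[OF closed_cutoff_shell])
  have gB [measurable]: "(\<lambda>x. g x * indicator B x) \<in> borel_measurable borel"
    using ug B by (simp add: upper_gradient_def borel_measurable_restrict_space_iff_ennreal)
  have "(\<lambda>x. v x * indicator ?S x) \<in> borel_measurable borel"
    using S continuous_on_subset[OF v \<open>?S \<subseteq> B\<close>] by (rule borel_measurable_times_indicator)
  then have "(\<lambda>x. ennreal (\<bar>v x * indicator ?S x\<bar> / \<rho>)) \<in> borel_measurable borel"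
    by measurable
  also have "(\<lambda>x. ennreal (\<bar>v x * indicator ?S x\<bar> / \<rho>)) = (\<lambda>x. ennreal (\<bar>v x\<bar> / \<rho>) * indicator ?S x)"
    by (auto simp: indicator_def)
  finally have vS [measurable]: "(\<lambda>x. ennreal (\<bar>v x\<bar> / \<rho>) * indicator ?S x) \<in> borel_measurable borel" .
  have "upper_gradient_ineq (\<lambda>x. ereal (?w x)) ?G \<gamma>" if \<gamma>: "\<gamma> \<in> rect_paths UNIV" for \<gamma>
  proof -
    let ?h = "arclength_param \<gamma>"
    define l where "l = arclength \<gamma> 1"
    have l: "0 \<le> l" by (simp add: l_def)
    \<comment> \<open>Clamping makes the curve 1-Lipschitz on the whole real line, hence
      Borel.\<close>
    define h where "h s = ?h (max 0 (min l s))" for s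
    have h_eq: "?h s = h s" if "0 \<le> s" "s \<le> l" for s using that by (simp add: h_def)
    have h_dist: "dist (h s) (h t) \<le> \<bar>s - t\<bar>" for s t
    proof -
      have "dist (h s) (h t) \<le> \<bar>max 0 (min l s) - max 0 (min l t)\<bar>"
        unfolding h_def by (rule dist_arclength_param_le[OF \<gamma>]) (use l in \<open>auto simp: l_def\<close>)
      also have "\<dots> \<le> \<bar>s - t\<bar>" by linarith
      finally show ?thesis .
    qed
    have "continuous_on UNIV h"
      by (rule lipschitz_on_continuous_on[of 1]) (auto intro!: lipschitz_onI h_dist simp: dist_real_def)
    then have h: "h \<in> borel_measurable borel" by (rule borel_measurable_continuous_onI)
    have gBh [measurable]: "(\<lambda>s. g (h s) * indicator B (h s)) \<in> borel_measurable borel"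
      using measurable_compose[OF h gB] .
    have vSh [measurable]: "(\<lambda>s. ennreal (\<bar>v (h s)\<bar> / \<rho>) * indicator ?S (h s)) \<in> borel_measurable borel"
      using measurable_compose[OF h vS] .
    have "ennreal \<bar>?w (h 0) - ?w (h l)\<bar> \<le> (\<integral>\<^sup>+s\<in>{0..l}. ?G (h s) \<partial>lborel)"
    proof (rule ennreal_le_epsilon)
      fix e :: real assume "0 < e"
      \<comment> \<open>The error \<open>\<epsilon>\<close> is integrated over an interval of length
        \<open>l\<close>; the summand 1 prevents division by zero.\<close>
      define \<epsilon> where "\<epsilon> = e / (l + 1)"
      have \<epsilon>: "0 < \<epsilon>" "\<epsilon> * l \<le> e" using \<open>0 < e\<close> l by (auto simp: \<epsilon>_def field_simps)
      have "uniformly_continuous_on ?N v"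
        using continuous_on_subset[OF v sub] cpt by (rule compact_uniformly_continuous)
      then obtain \<delta>' where \<delta>': "0 < \<delta>'"
        "\<And>x y. \<lbrakk>x \<in> ?N; y \<in> ?N; dist y x < \<delta>'\<rbrakk> \<Longrightarrow> dist (v y) (v x) < \<epsilon> * \<rho>"
        using \<epsilon> \<rho> unfolding uniformly_continuous_on_def by (metis mult_pos_pos)
      \<comment> \<open>On a subarc of length at most \<open>\<delta>\<close> the distance to
        \<open>K\<close> varies by at most \<open>\<rho> / 4\<close>: starting below
        \<open>2 * \<rho>\<close> it stays below \<open>3 * \<rho>\<close>, and starting above
        \<open>\<rho>\<close> it stays above \<open>\<rho> / 2\<close>. Halving
        \<open>\<delta>'\<close> keeps the bound for uniform continuity strict.\<close>
      define \<delta> where "\<delta> = min (\<delta>' / 2) (\<rho> / 4)"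
      have \<delta>: "0 < \<delta>" "\<delta> < \<delta>'" "\<delta> \<le> \<rho> / 4" using \<delta>' \<rho> by (auto simp: \<delta>_def)
      let ?H = "\<lambda>s. ?G (h s) + ennreal \<epsilon>"
      have "ennreal \<bar>?w (h 0) - ?w (h l)\<bar> \<le> (\<integral>\<^sup>+s\<in>{0..l}. ?H s \<partial>lborel)"
      proof (rule local_to_global_estimate[of ?H \<delta> l "\<lambda>s. ?w (h s)"])
        fix a b assume ab: "0 \<le> a" "a \<le> b" "b \<le> l" "b - a \<le> \<delta>"
        have inf: "\<bar>infdist (h s) K - infdist (h t) K\<bar> \<le> \<rho> / 4" if "s \<in> {a..b}" "t \<in> {a..b}" for s t
        proof -
          have "\<bar>s - t\<bar> \<le> \<rho> / 4" using that ab \<delta> unfolding atLeastAtMost_iff by linarith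
          then show ?thesis using infdist_triangle_abs[of "h s" K "h t"] h_dist[of s t] by linarith
        qed
        show "ennreal \<bar>?w (h a) - ?w (h b)\<bar> \<le> (\<integral>\<^sup>+s\<in>{a..b}. ?H s \<partial>lborel)"
        \<comment> \<open>If both cutoff values vanish, so does the left side. Otherwise an end
          point is nearer to \<open>K\<close> than \<open>2 * \<rho>\<close>, which keeps the whole
          arc in \<open>?N\<close> and thus in \<open>B\<close>, where \<open>v\<close> and
          \<open>g\<close> are controlled.\<close>
        proof (cases "cutoff K \<rho> (h a) = 0 \<and> cutoff K \<rho> (h b) = 0")
          case False
          then obtain t where "t \<in> {a..b}" "infdist (h t) K < 2 * \<rho>"
            using ab cutoff_eq_0[OF \<rho>, of "h a" K] cutoff_eq_0[OF \<rho>, of "h b" K]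
            by (metis atLeastAtMost_iff linorder_not_le order_refl)
          then have N: "h s \<in> ?N" if "s \<in> {a..b}" for s
            using inf[OF that \<open>t \<in> {a..b}\<close>] \<open>infdist (h t) K < 2 * \<rho>\<close> \<rho> unfolding mem_Collect_eq by linarith
          have 1: "ennreal \<bar>v (h a) - v (h b)\<bar> \<le> (\<integral>\<^sup>+s\<in>{a..b}. g (h s) * indicator B (h s) \<partial>lborel)"
          proof -
            have "?h ` {a..b} \<subseteq> B" using N sub ab h_eq by force
            then have "ennreal \<bar>v (h a) - v (h b)\<bar> \<le> (\<integral>\<^sup>+s\<in>{a..b}. g (?h s) \<partial>lborel)"
              using upper_gradient_arclength[OF \<gamma> _ ug, of a b] B ab h_eq by (simp add: l_def)
            also have "\<dots> = (\<integral>\<^sup>+s\<in>{a..b}. g (h s) * indicator B (h s) \<partial>lborel)"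
              using N sub ab h_eq by (intro nn_integral_cong) (force simp: indicator_def)
            finally show ?thesis .
          qed
          have 2: "ennreal (\<bar>v (h b)\<bar> * \<bar>cutoff K \<rho> (h a) - cutoff K \<rho> (h b)\<bar>)
              \<le> (\<integral>\<^sup>+s\<in>{a..b}. ennreal (\<bar>v (h s)\<bar> / \<rho>) * indicator ?S (h s) + ennreal \<epsilon> \<partial>lborel)"
          proof (cases "cutoff K \<rho> (h a) = cutoff K \<rho> (h b)")
            case False
            \<comment> \<open>The two cutoff values differ, so they are not both 1 and some end
              point is farther than \<open>\<rho>\<close> from \<open>K\<close>; this places the arc
              in the shell.\<close>
            then obtain t where "t \<in> {a..b}" "\<rho> < infdist (h t) K"
              using ab cutoff_eq_1[OF \<rho>, of "h a" K] cutoff_eq_1[OF \<rho>, of "h b" K]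
              by (metis atLeastAtMost_iff linorder_not_le order_refl)
            then have S: "h s \<in> ?S" if "s \<in> {a..b}" for s
              using inf[OF that \<open>t \<in> {a..b}\<close>] \<open>\<rho> < infdist (h t) K\<close> \<rho> N[OF that]
              unfolding cutoff_shell_def mem_Collect_eq by linarith
            have vb: "\<bar>v (h b)\<bar> / \<rho> \<le> \<bar>v (h s)\<bar> / \<rho> + \<epsilon>" if "s \<in> {a..b}" for s
            proof -
              have "dist (h s) (h b) < \<delta>'" using h_dist[of s b] that ab \<delta> by auto
              then have "\<bar>v (h s) - v (h b)\<bar> < \<epsilon> * \<rho>"
                using \<delta>'(2)[of "h b" "h s"] N[of b] N[OF that] ab by (simp add: dist_real_def)
              then have "\<bar>v (h b)\<bar> \<le> \<bar>v (h s)\<bar> + \<epsilon> * \<rho>" by linarith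
              then show ?thesis using \<rho> by (simp add: field_simps)
            qed
            have "\<bar>v (h b)\<bar> * \<bar>cutoff K \<rho> (h a) - cutoff K \<rho> (h b)\<bar> \<le> \<bar>v (h b)\<bar> * ((b - a) / \<rho>)"
            proof (rule mult_left_mono)
              have "\<bar>cutoff K \<rho> (h a) - cutoff K \<rho> (h b)\<bar> \<le> dist (h a) (h b) / \<rho>"
                by (rule cutoff_lipschitz[OF \<rho>])
              also have "\<dots> \<le> (b - a) / \<rho>"
                using h_dist[of a b] ab \<rho> by (intro divide_right_mono) auto
              finally show "\<bar>cutoff K \<rho> (h a) - cutoff K \<rho> (h b)\<bar> \<le> (b - a) / \<rho>" .
            qed simp
            then have "ennreal (\<bar>v (h b)\<bar> * \<bar>cutoff K \<rho> (h a) - cutoff K \<rho> (h b)\<bar>)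
                \<le> ennreal (\<bar>v (h b)\<bar> / \<rho>) * ennreal (b - a)"
              using \<rho> ab by (simp add: ennreal_mult[symmetric] ennreal_leI)
            also have "\<dots> = (\<integral>\<^sup>+s\<in>{a..b}. ennreal (\<bar>v (h b)\<bar> / \<rho>) \<partial>lborel)"
              using ab by (simp add: nn_integral_cmult_indicator)
            also have "\<dots> \<le> (\<integral>\<^sup>+s\<in>{a..b}. ennreal (\<bar>v (h s)\<bar> / \<rho>) * indicator ?S (h s) + ennreal \<epsilon> \<partial>lborel)"
              using S vb \<epsilon> \<rho> by (intro nn_integral_mono)
                (auto simp: indicator_def ennreal_plus[symmetric] simp del: ennreal_plus intro!: ennreal_leI)
            finally show ?thesis .
          qed simp
          have "\<bar>?w (h a) - ?w (h b)\<bar> \<le> \<bar>v (h a) - v (h b)\<bar> +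
              \<bar>v (h b)\<bar> * \<bar>cutoff K \<rho> (h a) - cutoff K \<rho> (h b)\<bar>"
          proof -
            have "?w (h a) - ?w (h b) = cutoff K \<rho> (h a) * (v (h a) - v (h b)) +
                v (h b) * (cutoff K \<rho> (h a) - cutoff K \<rho> (h b))"
              by (simp add: algebra_simps)
            then have "\<bar>?w (h a) - ?w (h b)\<bar> \<le> \<bar>cutoff K \<rho> (h a) * (v (h a) - v (h b))\<bar> +
                \<bar>v (h b) * (cutoff K \<rho> (h a) - cutoff K \<rho> (h b))\<bar>"
              by linarith
            moreover have "cutoff K \<rho> (h a) * \<bar>v (h a) - v (h b)\<bar> \<le> \<bar>v (h a) - v (h b)\<bar>"
              by (rule mult_left_le_one_le) (auto simp: cutoff_range)
            ultimately show ?thesis by (simp add: abs_mult cutoff_range)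
          qed
          then have "ennreal \<bar>?w (h a) - ?w (h b)\<bar> \<le> ennreal (\<bar>v (h a) - v (h b)\<bar> +
              \<bar>v (h b)\<bar> * \<bar>cutoff K \<rho> (h a) - cutoff K \<rho> (h b)\<bar>)"
            by (rule ennreal_leI)
          also have "\<dots> = ennreal \<bar>v (h a) - v (h b)\<bar> +
              ennreal (\<bar>v (h b)\<bar> * \<bar>cutoff K \<rho> (h a) - cutoff K \<rho> (h b)\<bar>)"
            by (rule ennreal_plus) auto
          also have "\<dots> \<le> (\<integral>\<^sup>+s\<in>{a..b}. g (h s) * indicator B (h s) \<partial>lborel) +
              (\<integral>\<^sup>+s\<in>{a..b}. ennreal (\<bar>v (h s)\<bar> / \<rho>) * indicator ?S (h s) + ennreal \<epsilon> \<partial>lborel)"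
            by (rule add_mono[OF 1 2])
          also have "\<dots> = (\<integral>\<^sup>+s\<in>{a..b}. ?H s \<partial>lborel)"
            by (subst nn_integral_add[symmetric]) (measurable, simp add: distrib_right add.assoc)
          finally show ?thesis .
        qed simp
      qed (use \<delta> l in auto)
      also have "\<dots> = (\<integral>\<^sup>+s. ?G (h s) * indicator {0..l} s + ennreal \<epsilon> * indicator {0..l} s \<partial>lborel)"
        by (auto intro!: nn_integral_cong simp: indicator_def)
      also have "\<dots> = (\<integral>\<^sup>+s\<in>{0..l}. ?G (h s) \<partial>lborel) + ennreal (\<epsilon> * l)"
        using l \<epsilon> by (subst nn_integral_add) (auto simp: nn_integral_cmult_indicator ennreal_mult)
      also have "\<dots> \<le> (\<integral>\<^sup>+s\<in>{0..l}. ?G (h s) \<partial>lborel) + ennreal e"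
        using \<epsilon> by (intro add_left_mono ennreal_leI)
      finally show "ennreal \<bar>?w (h 0) - ?w (h l)\<bar> \<le> (\<integral>\<^sup>+s\<in>{0..l}. ?G (h s) \<partial>lborel) + ennreal e" .
    qed
    also have "\<dots> = line_integral ?G \<gamma>"
      unfolding line_integral_eq[OF \<gamma>] nn_integral_completion l_def[symmetric]
      by (rule nn_integral_cong) (simp add: h_eq indicator_def)
    finally have "ennreal \<bar>?w (pathstart \<gamma>) - ?w (pathfinish \<gamma>)\<bar> \<le> line_integral ?G \<gamma>"
      using arclength_param_0[OF \<gamma>] arclength_param_end[OF \<gamma>] l by (simp add: h_eq[symmetric] l_def)
    then show ?thesis
      by (simp add: upper_gradient_ineq_def ennreal.rep_eq less_eq_ennreal.rep_eq)
  qed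
  then show ?thesis
    using borel_measurable_add[OF gB vS]
    by (simp add: upper_gradient_def borel_measurable_restrict_space_iff_ennreal)
qed

section \<open>Doubling measures\<close>

context
  fixes \<mu> :: "'a::complete_space set \<Rightarrow> ennreal"
  assumes \<mu>: "borel_regular_outer_measure \<mu>"
begin

lemma space_outer_to_measure: "space (outer_to_measure \<mu>) = UNIV"
  by (simp add: outer_to_measure_def space_measure_of_conv)

lemma borel_sets_outer_to_measure:
  assumes "A \<in> sets borel"
  shows "A \<in> sets (outer_to_measure \<mu>)"
  using \<mu> assms by (auto simp: borel_regular_outer_measure_def sets_outer_to_measure)

lemma emeasure_outer_to_measure_borel:
  assumes "A \<in> sets borel"
  shows "emeasure (outer_to_measure \<mu>) A = \<mu> A"
  using \<mu> assms by (auto simp: borel_regular_outer_measure_def intro!: emeasure_outer_to_measure)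

lemma borel_measurable_outer_to_measure:
  assumes "f \<in> borel_measurable borel"
  shows "f \<in> borel_measurable (outer_to_measure \<mu>)"
  using assms by (auto simp: measurable_def space_outer_to_measure intro: borel_sets_outer_to_measure)

text \<open>The exceptional family is empty. Line integrals are well defined because a Borel
  function is composed with a continuous parametrization.\<close>

lemma upper_gradient_imp_weak_upper_gradient1:
  assumes "upper_gradient UNIV u g"
  shows "weak_upper_gradient1 \<mu> UNIV u g"
proof -
  have g: "g \<in> borel_measurable borel"
    using assms by (simp add: upper_gradient_def borel_measurable_restrict_space_iff_ennreal)
  have "modulus1 \<mu> UNIV {} \<le> (\<integral>\<^sup>+x\<in>UNIV. 0 \<partial>outer_to_measure \<mu>)"
    unfolding modulus1_def by (rule INF_lower) simp
  then have "modulus1 \<mu> UNIV {} = 0" by simp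
  moreover have "line_integral_defined g \<gamma>" if \<gamma>: "\<gamma> \<in> rect_paths UNIV" for \<gamma> :: "real \<Rightarrow> 'a"
  proof -
    let ?S = "{0..arclength \<gamma> 1}"
    have "arclength_param \<gamma> \<in> borel_measurable (restrict_space borel ?S)"
      by (rule borel_measurable_continuous_on_restrict[OF continuous_on_arclength_param[OF \<gamma>]])
    then have "(\<lambda>s. g (arclength_param \<gamma> s)) \<in> borel_measurable (restrict_space borel ?S)"
      using g by (rule measurable_compose)
    then have "(\<lambda>s. g (arclength_param \<gamma> s) * indicator ?S s) \<in> borel_measurable lborel"
      by (simp add: borel_measurable_restrict_space_iff_ennreal)
    then have "(\<lambda>s. g (arclength_param \<gamma> s) * indicator ?S s) \<in> borel_measurable lebesgue"
      by (rule measurable_completion)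
    then show ?thesis
      by (simp add: line_integral_defined_def borel_measurable_restrict_space_iff_ennreal arclength_def)
  qed
  moreover have "g \<in> borel_measurable (outer_to_measure \<mu>)"
    by (rule borel_measurable_outer_to_measure[OF g])
  ultimately show ?thesis
    unfolding weak_upper_gradient1_def
  proof (intro conjI exI[of _ "{}"] ballI)
    fix \<gamma> :: "real \<Rightarrow> 'a" assume "\<gamma> \<in> rect_paths UNIV - {}"
    then show "upper_gradient_ineq u g \<gamma>" using assms by (simp add: upper_gradient_def)
  qed (auto intro: measurable_restrict_space1)
qed

context
  assumes pos: "positive_finite_on_balls \<mu>"
begin

lemma emeasure_ball_pos_finite:
  assumes "0 < r"
  shows "0 < emeasure (outer_to_measure \<mu>) (ball x r)" "emeasure (outer_to_measure \<mu>) (ball x r) < \<infinity>"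
  using pos assms by (auto simp: positive_finite_on_balls_def emeasure_outer_to_measure_borel)

lemma continuous_imp_locally_integrable:
  fixes w :: "'a \<Rightarrow> real"
  assumes "continuous_on UNIV w"
  shows "locally_integrable \<mu> UNIV (\<lambda>x. ereal (w x))"
proof -
  have w: "w \<in> borel_measurable (outer_to_measure \<mu>)"
    using assms by (intro borel_measurable_outer_to_measure borel_measurable_continuous_onI)
  have "(\<integral>\<^sup>+x\<in>K. e2ennreal \<bar>ereal (w x)\<bar> \<partial>outer_to_measure \<mu>) < \<infinity>" if K: "compact K" for K
  proof -
    have "bounded (w ` K)"
      using compact_continuous_image[OF continuous_on_subset[OF assms subset_UNIV] K] by (rule compact_imp_bounded)
    then obtain c where c: "\<And>x. x \<in> K \<Longrightarrow> \<bar>w x\<bar> \<le> c" by (auto simp: bounded_iff)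
    \<comment> \<open>Any centre will do, since a compact set lies in some ball around each
      point.\<close>
    obtain R where R: "0 < R" "K \<subseteq> ball undefined R"
      using bounded_subset_ballD[OF compact_imp_bounded[OF K]] by blast
    have "(\<integral>\<^sup>+x\<in>K. e2ennreal \<bar>ereal (w x)\<bar> \<partial>outer_to_measure \<mu>)
        \<le> (\<integral>\<^sup>+x\<in>ball undefined R. ennreal c \<partial>outer_to_measure \<mu>)"
      using c R by (intro nn_integral_mono) (auto simp: indicator_def e2ennreal_ereal ennreal_leI)
    also have "\<dots> = ennreal c * emeasure (outer_to_measure \<mu>) (ball undefined R)"
      by (rule nn_integral_cmult_indicator) (simp add: borel_sets_outer_to_measure)
    also have "\<dots> < \<infinity>"
      using emeasure_ball_pos_finite[OF R(1)] by (simp add: ennreal_mult_less_top)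
    finally show ?thesis .
  qed
  moreover have "(\<lambda>x. ereal (w x)) \<in> borel_measurable (restrict_space (outer_to_measure \<mu>) UNIV)"
    using w by (intro measurable_restrict_space1) measurable
  ultimately show ?thesis by (simp add: locally_integrable_def)
qed

section \<open>Volume packing and compactness of closed balls\<close>

context
  fixes C\<^sub>D :: real
  assumes doubling: "doubling_measure \<mu> C\<^sub>D"
begin

text \<open>The doubling constant carries no sign assumption: \<open>ennreal\<close> sends a
  negative number to 0, but its even powers are positive. The power is therefore taken of
  \<open>max 0 C\<^sub>D\<close>.\<close>

lemma emeasure_ball_doubling:
  assumes "0 < r"
  shows "emeasure (outer_to_measure \<mu>) (ball x (2 ^ k * r))
    \<le> ennreal (max 0 C\<^sub>D ^ k) * emeasure (outer_to_measure \<mu>) (ball x r)"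
proof (induction k)
  case (Suc k)
  have "\<mu> (ball x (2 * (2 ^ k * r))) \<le> ennreal C\<^sub>D * \<mu> (ball x (2 ^ k * r))"
    using doubling assms unfolding doubling_measure_def by simp
  also have "\<dots> \<le> ennreal (max 0 C\<^sub>D) * (ennreal (max 0 C\<^sub>D ^ k) * \<mu> (ball x r))"
    using Suc by (intro mult_mono ennreal_leI) (auto simp: emeasure_outer_to_measure_borel)
  also have "\<dots> = ennreal (max 0 C\<^sub>D ^ Suc k) * \<mu> (ball x r)"
    by (simp add: ennreal_mult mult.assoc)
  finally show ?case by (simp add: emeasure_outer_to_measure_borel mult.assoc)
qed simp

text \<open>Volume packing: the balls of radius \<open>e / 2\<close> around points of
  \<open>F\<close> are disjoint and contained in \<open>ball x0 (R + e)\<close>. Each point of this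
  ball is within \<open>2 * R + e\<close> of every centre, so \<open>k\<close> doublings of a small
  ball cover it, and its measure is at most \<open>max 0 C\<^sub>D ^ k\<close> times that of any
  small ball.\<close>

lemma doubling_separated_card_le:
  fixes x0 :: 'a
  assumes "0 < e" "0 \<le> R" "2 * R + e \<le> 2 ^ k * (e / 2)" "finite F" "F \<subseteq> cball x0 R"
    and sep: "\<And>x y. \<lbrakk>x \<in> F; y \<in> F; x \<noteq> y\<rbrakk> \<Longrightarrow> e \<le> dist x y"
  shows "real (card F) \<le> max 0 C\<^sub>D ^ k"
proof -
  let ?M = "outer_to_measure \<mu>"
  define V where "V = emeasure ?M (ball x0 (R + e))"
  have V: "0 < V" "V < \<infinity>" using assms(1,2) emeasure_ball_pos_finite[of "R + e" x0] by (auto simp: V_def)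
  have "of_nat (card F) * V = (\<Sum>x\<in>F. V)" by simp
  also have "\<dots> \<le> (\<Sum>x\<in>F. ennreal (max 0 C\<^sub>D ^ k) * emeasure ?M (ball x (e / 2)))"
  proof (rule sum_mono)
    fix x assume "x \<in> F"
    then have "dist x x0 \<le> R" using assms(5) by (auto simp: dist_commute)
    have "ball x0 (R + e) \<subseteq> ball x (2 ^ k * (e / 2))"
    proof
      fix y assume "y \<in> ball x0 (R + e)"
      then have "dist x0 y < R + e" by simp
      then have "dist x y < 2 ^ k * (e / 2)"
        using dist_triangle[of x y x0] \<open>dist x x0 \<le> R\<close> assms(3) by linarith
      then show "y \<in> ball x (2 ^ k * (e / 2))" by simp
    qed
    then have "V \<le> emeasure ?M (ball x (2 ^ k * (e / 2)))"
      unfolding V_def by (intro emeasure_mono borel_sets_outer_to_measure) auto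
    also have "\<dots> \<le> ennreal (max 0 C\<^sub>D ^ k) * emeasure ?M (ball x (e / 2))"
      using assms(1) by (intro emeasure_ball_doubling) auto
    finally show "V \<le> ennreal (max 0 C\<^sub>D ^ k) * emeasure ?M (ball x (e / 2))" .
  qed
  also have "\<dots> = ennreal (max 0 C\<^sub>D ^ k) * (\<Sum>x\<in>F. emeasure ?M (ball x (e / 2)))"
    by (simp add: sum_distrib_left)
  also have "(\<Sum>x\<in>F. emeasure ?M (ball x (e / 2))) = emeasure ?M (\<Union>x\<in>F. ball x (e / 2))"
  proof (rule sum_emeasure)
    show "(\<lambda>x. ball x (e / 2)) ` F \<subseteq> sets ?M" using borel_sets_outer_to_measure by auto
    show "disjoint_family_on (\<lambda>x. ball x (e / 2)) F"
      unfolding disjoint_family_on_def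
    proof (intro ballI impI)
      fix x y assume xy: "x \<in> F" "y \<in> F" "x \<noteq> y"
      have "e \<le> dist x y" using sep xy by blast
      then have "\<not> (dist x z < e / 2 \<and> dist y z < e / 2)" for z
        using dist_triangle2[of x y z] by linarith
      then show "ball x (e / 2) \<inter> ball y (e / 2) = {}" by auto
    qed
  qed (use assms(4) in auto)
  also have "emeasure ?M (\<Union>x\<in>F. ball x (e / 2)) \<le> V"
    unfolding V_def
  proof (rule emeasure_mono)
    show "(\<Union>x\<in>F. ball x (e / 2)) \<subseteq> ball x0 (R + e)"
    proof
      fix z assume "z \<in> (\<Union>x\<in>F. ball x (e / 2))"
      then obtain x where "x \<in> F" "dist x z < e / 2" by auto
      moreover have "dist x0 x \<le> R" using assms(5) \<open>x \<in> F\<close> by auto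
      ultimately have "dist x0 z < R + e"
        using dist_triangle[of x0 z x] assms(1) by linarith
      then show "z \<in> ball x0 (R + e)" by simp
    qed
  qed (simp add: borel_sets_outer_to_measure)
  finally have "of_nat (card F) * V \<le> ennreal (max 0 C\<^sub>D ^ k) * V" by (simp add: mult_left_mono)
  then have "of_nat (card F) \<le> ennreal (max 0 C\<^sub>D ^ k)"
    using V ennreal_mult_le_mult_iff[of V "of_nat (card F)" "ennreal (max 0 C\<^sub>D ^ k)"]
    by (simp add: mult.commute)
  then show ?thesis by (simp add: ennreal_of_nat_eq_real_of_nat)
qed

text \<open>An \<open>e\<close>-separated set of maximal cardinality, which exists by the packing
  bound, is an \<open>e\<close>-net: a point that it misses could be added to it. Total boundedness
  and completeness then give compactness.\<close>

lemma compact_cball_doubling: "compact (cball (x0 :: 'a) R)"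
proof (cases "0 \<le> R")
  case True
  have "\<exists>F. finite F \<and> cball x0 R \<subseteq> (\<Union>x\<in>F. ball x e)" if "0 < e" for e
  proof -
    obtain k where "2 * (2 * R + e) / e < 2 ^ k" using real_arch_pow[of 2] by auto
    then have k: "2 * R + e \<le> 2 ^ k * (e / 2)" using that by (simp add: field_simps)
    define P where "P F \<longleftrightarrow> finite F \<and> F \<subseteq> cball x0 R \<and> (\<forall>x\<in>F. \<forall>y\<in>F. x \<noteq> y \<longrightarrow> e \<le> dist x y)" for F
    have "card F < Suc (nat \<lceil>max 0 C\<^sub>D ^ k\<rceil>)" if "P F" for F
    proof -
      have "real (card F) \<le> max 0 C\<^sub>D ^ k"
        using that by (intro doubling_separated_card_le[OF \<open>0 < e\<close> True k, of F x0]) (auto simp: P_def)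
      also have "\<dots> \<le> real (nat \<lceil>max 0 C\<^sub>D ^ k\<rceil>)" by (rule real_nat_ceiling_ge)
      finally show ?thesis by simp
    qed
    moreover have "P {}" by (simp add: P_def)
    ultimately have "\<exists>F. P F \<and> (\<forall>F'. P F' \<longrightarrow> card F' \<le> card F)"
      by (intro Lattices_Big.ex_has_greatest_nat[of P "{}" card]) auto
    then obtain F where F: "P F" "\<And>F'. P F' \<Longrightarrow> card F' \<le> card F" by blast
    have "z \<in> (\<Union>x\<in>F. ball x e)" if "z \<in> cball x0 R" for z
    proof (rule ccontr)
      assume z: "z \<notin> (\<Union>x\<in>F. ball x e)"
      then have "e \<le> dist x z" if "x \<in> F" for x using that by (auto simp: not_less)
      with F(1) that have "P (insert z F)" by (auto simp: P_def dist_commute)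
      moreover have "z \<notin> F" using z \<open>0 < e\<close> by auto
      ultimately show False using F(2)[of "insert z F"] F(1) by (simp add: P_def)
    qed
    then show ?thesis using F(1) by (auto simp: P_def)
  qed
  moreover have "complete (cball x0 R)" by (simp add: complete_eq_closed)
  ultimately show ?thesis by (simp add: compact_eq_totally_bounded)
qed simp

end

end

end

section \<open>The Poincare inequality for compactly supported functions\<close>

lemma ennreal_le_mult_of_divide_le:
  assumes "0 < c" "X / ennreal c \<le> Y"
  shows "X \<le> ennreal c * Y"
proof -
  have "X = X / ennreal c * ennreal c"
    using assms(1) by (simp add: ennreal_divide_times)
  also have "\<dots> \<le> Y * ennreal c" by (rule mult_right_mono[OF assms(2)]) simp
  finally show ?thesis by (simp add: mult.commute)
qed

text \<open>The integral of \<open>\<bar>w\<bar>\<close> is at most the oscillation \<open>I\<close>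
  plus \<open>\<bar>m\<bar>\<close> times the measure of the large ball. Where \<open>w\<close>
  vanishes, \<open>\<bar>w - m\<bar>\<close> equals \<open>\<bar>m\<bar>\<close>, so
  \<open>\<bar>m\<bar>\<close> times the measure of the small ball is at most \<open>I\<close>.
  Doubling \<open>k\<close> times passes to the large ball, which yields the factor
  \<open>1 + max 0 C\<^sub>D ^ k\<close>.\<close>

lemma poincare_zero_on_ball:
  fixes w :: "'a::complete_space \<Rightarrow> real" and \<mu> :: "'a set \<Rightarrow> ennreal"
  assumes \<mu>: "borel_regular_outer_measure \<mu>" "positive_finite_on_balls \<mu>" "doubling_measure \<mu> C\<^sub>D"
    and poincare: "weak_poincare11 \<mu> C\<^sub>P \<tau>" and "0 < C\<^sub>P" "1 \<le> \<tau>" "0 < R" "0 < s"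
    and w: "continuous_on UNIV w" and ug: "upper_gradient UNIV (\<lambda>x. ereal (w x)) G"
    and zero: "\<And>x. x \<in> ball y0 s \<Longrightarrow> w x = 0"
    and sub: "ball y0 s \<subseteq> ball x0 R" and big: "ball x0 R \<subseteq> ball y0 (2 ^ k * s)"
  shows "(\<integral>\<^sup>+x\<in>ball x0 R. ennreal \<bar>w x\<bar> \<partial>outer_to_measure \<mu>)
    \<le> ennreal (C\<^sub>P * R * (1 + max 0 C\<^sub>D ^ k)) * (\<integral>\<^sup>+x. G x \<partial>outer_to_measure \<mu>)"
proof -
  let ?M = "outer_to_measure \<mu>"
  note borel_sets = borel_sets_outer_to_measure[OF \<mu>(1)]
  note emeasure_eq = emeasure_outer_to_measure_borel[OF \<mu>(1)]
  define m where "m = mean_value \<mu> (ball x0 R) (\<lambda>x. ereal (w x))"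
  define V where "V = emeasure ?M (ball x0 R)"
  define I where "I = (\<integral>\<^sup>+x\<in>ball x0 R. ennreal \<bar>w x - m\<bar> \<partial>?M)"
  define J where "J = (\<integral>\<^sup>+x. G x \<partial>?M)"
  have V: "V \<noteq> 0" "V \<noteq> top"
    using emeasure_ball_pos_finite[OF \<mu>(1,2) \<open>0 < R\<close>, of x0] by (auto simp: V_def)
  have balls [measurable]: "ball x t \<in> sets ?M" for x t by (simp add: borel_sets)
  have w_meas [measurable]: "w \<in> borel_measurable ?M"
    using borel_measurable_outer_to_measure[OF \<mu>(1) borel_measurable_continuous_onI[OF w]] .
  have "R \<le> \<tau> * R" using \<open>1 \<le> \<tau>\<close> \<open>0 < R\<close> by simp
  have "(\<integral>\<^sup>+y\<in>ball x0 R. e2ennreal \<bar>ereal (w y) - ereal m\<bar> \<partial>?M) / \<mu> (ball x0 R)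
      \<le> ennreal (C\<^sub>P * R) * ((\<integral>\<^sup>+y\<in>ball x0 (\<tau> * R). G y \<partial>?M) / \<mu> (ball x0 (\<tau> * R)))"
    using poincare \<open>0 < R\<close> continuous_imp_locally_integrable[OF \<mu>(1,2) w]
      upper_gradient_imp_weak_upper_gradient1[OF \<mu>(1) ug]
    unfolding weak_poincare11_def m_def by blast
  then have "I / V \<le> ennreal (C\<^sub>P * R) *
      ((\<integral>\<^sup>+y\<in>ball x0 (\<tau> * R). G y \<partial>?M) / emeasure ?M (ball x0 (\<tau> * R)))"
    by (simp add: I_def V_def emeasure_eq)
  \<comment> \<open>The dilated ball disappears: integrating over all of X only raises the numerator
    to \<open>J\<close>, and \<open>V\<close> bounds the denominator from below.\<close>
  also have "\<dots> \<le> ennreal (C\<^sub>P * R) * (J / V)"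
  proof (rule mult_left_mono)
    have "(\<integral>\<^sup>+y\<in>ball x0 (\<tau> * R). G y \<partial>?M) \<le> J"
      unfolding J_def by (rule nn_integral_mono) (auto simp: indicator_def)
    moreover have "V \<le> emeasure ?M (ball x0 (\<tau> * R))"
      unfolding V_def by (rule emeasure_mono[OF subset_ball[OF \<open>R \<le> \<tau> * R\<close>] balls])
    moreover have "J = V * (J / V)"
      using V by (simp add: ennreal_times_divide ennreal_mult_divide_eq mult.commute)
    ultimately have "(\<integral>\<^sup>+y\<in>ball x0 (\<tau> * R). G y \<partial>?M) \<le> emeasure ?M (ball x0 (\<tau> * R)) * (J / V)"
      by (metis (no_types, lifting) mult_right_mono order_trans zero_le)
    moreover have "0 < emeasure ?M (ball x0 (\<tau> * R))"
      using \<open>0 < R\<close> \<open>1 \<le> \<tau>\<close> by (intro emeasure_ball_pos_finite[OF \<mu>(1,2)]) simp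
    ultimately show "(\<integral>\<^sup>+y\<in>ball x0 (\<tau> * R). G y \<partial>?M) / emeasure ?M (ball x0 (\<tau> * R)) \<le> J / V"
      by (intro divide_le_posI_ennreal)
  qed simp
  finally have "I / V * V \<le> ennreal (C\<^sub>P * R) * (J / V) * V" by (rule mult_right_mono) simp
  moreover have "y / V * V = y" for y
    using V by (simp add: ennreal_divide_times less_top)
  ultimately have I: "I \<le> ennreal (C\<^sub>P * R) * J" by (simp only: mult.assoc)
  have "ennreal \<bar>m\<bar> * V \<le> ennreal \<bar>m\<bar> * (ennreal (max 0 C\<^sub>D ^ k) * emeasure ?M (ball y0 s))"
  proof (rule mult_left_mono)
    have "V \<le> emeasure ?M (ball y0 (2 ^ k * s))"
      unfolding V_def by (rule emeasure_mono[OF big balls])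
    also have "\<dots> \<le> ennreal (max 0 C\<^sub>D ^ k) * emeasure ?M (ball y0 s)"
      by (rule emeasure_ball_doubling[OF \<mu> \<open>0 < s\<close>])
    finally show "V \<le> ennreal (max 0 C\<^sub>D ^ k) * emeasure ?M (ball y0 s)" .
  qed simp
  also have "\<dots> = ennreal (max 0 C\<^sub>D ^ k) * (\<integral>\<^sup>+x\<in>ball y0 s. ennreal \<bar>m\<bar> \<partial>?M)"
    by (simp add: nn_integral_cmult_indicator mult.left_commute)
  also have "\<dots> \<le> ennreal (max 0 C\<^sub>D ^ k) * I"
    unfolding I_def using zero sub
    by (intro mult_left_mono nn_integral_mono) (auto simp: indicator_def)
  finally have m: "ennreal \<bar>m\<bar> * V \<le> ennreal (max 0 C\<^sub>D ^ k) * I" .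
  have "(\<integral>\<^sup>+x\<in>ball x0 R. ennreal \<bar>w x\<bar> \<partial>?M)
      \<le> (\<integral>\<^sup>+x. ennreal \<bar>w x - m\<bar> * indicator (ball x0 R) x + ennreal \<bar>m\<bar> * indicator (ball x0 R) x \<partial>?M)"
    by (rule nn_integral_mono)
       (auto simp: indicator_def ennreal_plus[symmetric] simp del: ennreal_plus intro!: ennreal_leI)
  also have "\<dots> = I + ennreal \<bar>m\<bar> * V"
    unfolding I_def V_def by (subst nn_integral_add) (auto simp: nn_integral_cmult_indicator)
  also have "\<dots> \<le> I + ennreal (max 0 C\<^sub>D ^ k) * I" by (rule add_left_mono[OF m])
  also have "\<dots> = ennreal (1 + max 0 C\<^sub>D ^ k) * I" by (simp add: distrib_right)
  also have "\<dots> \<le> ennreal (1 + max 0 C\<^sub>D ^ k) * (ennreal (C\<^sub>P * R) * J)" by (rule mult_left_mono[OF I]) simp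
  also have "\<dots> = ennreal (C\<^sub>P * R * (1 + max 0 C\<^sub>D ^ k)) * J"
    using \<open>0 < C\<^sub>P\<close> \<open>0 < R\<close>
    by (subst mult.assoc[symmetric], subst ennreal_mult[symmetric]) (simp_all add: mult.commute)
  finally show ?thesis by (simp add: J_def)
qed

section \<open>Passing from Lipschitz approximations to functions of bounded variation\<close>

lemma locally_lipschitz_imp_continuous_on:
  assumes "open B" "locally_lipschitz_on B v"
  shows "continuous_on B v"
proof (rule continuous_at_imp_continuous_on, rule ballI)
  fix x assume "x \<in> B"
  then obtain e L where e: "0 < e" "L-lipschitz_on (ball x e \<inter> B) v"
    using assms(2) by (auto simp: locally_lipschitz_on_def)
  then have "continuous_on (ball x e \<inter> B) v" by (intro lipschitz_on_continuous_on)
  moreover have "open (ball x e \<inter> B)" "x \<in> ball x e \<inter> B" using assms(1) e \<open>x \<in> B\<close> by auto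
  ultimately show "isCont v x" by (simp add: continuous_on_eq_continuous_at)
qed

lemma compact_infdist_neighbourhood:
  assumes "compact K" "K \<noteq> {}" "open B" "K \<subseteq> B"
  obtains \<rho> where "0 < \<rho>" "{x. infdist x K \<le> 3 * \<rho>} \<subseteq> B"
proof -
  obtain e where e: "0 < e" "(\<Union>x\<in>K. ball x e) \<subseteq> B"
    using compact_subset_open_imp_ball_epsilon_subset assms by metis
  \<comment> \<open>The bound equals \<open>e / 2\<close>, strictly below \<open>e\<close>, so some
    point of \<open>K\<close> is at distance less than \<open>e\<close> even without attaining the
    infimum.\<close>
  have "x \<in> B" if "infdist x K \<le> 3 * (e / 6)" for x
  proof -
    have "(INF a\<in>K. dist x a) < e" using that e assms(2) by (simp add: infdist_notempty)
    then obtain a where "a \<in> K" "dist x a < e"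
      using assms(2) by (subst (asm) cINF_less_iff) auto
    then have "x \<in> (\<Union>x\<in>K. ball x e)" by (auto simp: dist_commute)
    then show ?thesis using e(2) by blast
  qed
  then show ?thesis using that[of "e / 6"] e(1) by auto
qed

text \<open>Solving the bound for \<open>a i\<close> leaves an eventual lower bound by a constant,
  which passes directly to the liminf. A finite \<open>d\<close> ensures that \<open>d * e i\<close>
  tends to 0.\<close>

lemma ennreal_le_liminf_of_perturbed:
  fixes a e :: "nat \<Rightarrow> ennreal"
  assumes "0 < c" "e \<longlonglongrightarrow> 0" and bound: "\<And>i. X \<le> ennreal c * a i + d * e i" and "d \<noteq> top"
  shows "X \<le> ennreal c * liminf a"
proof (rule ennreal_le_epsilon)
  fix \<epsilon> :: real assume "0 < \<epsilon>"
  have "(\<lambda>i. d * e i) \<longlonglongrightarrow> d * 0"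
    using assms by (intro ennreal_tendsto_cmult) (auto simp: less_top)
  then have "eventually (\<lambda>i. d * e i < ennreal \<epsilon>) sequentially"
    using \<open>0 < \<epsilon>\<close> by (intro order_tendstoD) auto
  then have "eventually (\<lambda>i. (X - ennreal \<epsilon>) / ennreal c \<le> a i) sequentially"
  proof eventually_elim
    case (elim i)
    have "X \<le> ennreal \<epsilon> + ennreal c * a i"
      using bound[of i] elim by (metis add.commute add_left_mono dual_order.trans less_imp_le)
    then have "X - ennreal \<epsilon> \<le> ennreal c * a i" by (simp add: ennreal_minus_le_iff)
    then show ?case using assms(1) by (intro divide_le_posI_ennreal) auto
  qed
  then have "(X - ennreal \<epsilon>) / ennreal c \<le> liminf a" by (rule Liminf_bounded)
  then have "X - ennreal \<epsilon> \<le> ennreal c * liminf a"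
    by (rule ennreal_le_mult_of_divide_le[OF assms(1)])
  then show "X \<le> ennreal c * liminf a + ennreal \<epsilon>"
    by (simp add: ennreal_minus_le_iff add.commute)
qed

text \<open>The cutoff width depends on \<open>u\<close>, but it enters only the coefficient of the
  vanishing error. The factor in front of the total variation is the one from the zero-on-a-ball
  estimate.\<close>

lemma poincare_compact_support:
  fixes u :: "'a::complete_space \<Rightarrow> real" and \<mu> :: "'a set \<Rightarrow> ennreal"
  assumes \<mu>: "borel_regular_outer_measure \<mu>" "positive_finite_on_balls \<mu>" "doubling_measure \<mu> C\<^sub>D"
    and poincare: "weak_poincare11 \<mu> C\<^sub>P \<tau>" and "0 < C\<^sub>P" "1 \<le> \<tau>" "0 < R" "0 < s"
    and B: "open B" "B \<subseteq> ball x0 R" "ball y0 s \<inter> B = {}"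
    and sub: "ball y0 s \<subseteq> ball x0 R" and big: "ball x0 R \<subseteq> ball y0 (2 ^ k * s)"
    and u: "set_integrable (outer_to_measure \<mu>) B u"
    and supp: "compact (closure {x \<in> B. u x \<noteq> 0})" "closure {x \<in> B. u x \<noteq> 0} \<subseteq> B"
  shows "(\<integral>\<^sup>+x\<in>B. ennreal \<bar>u x\<bar> \<partial>outer_to_measure \<mu>)
    \<le> ennreal (C\<^sub>P * R * (1 + max 0 C\<^sub>D ^ k)) * total_variation \<mu> B u"
    (is "?X \<le> ennreal ?c * _")
proof (cases "{x \<in> B. u x \<noteq> 0} = {}")
  \<comment> \<open>Empty support is treated apart: \<open>infdist x {}\<close> is 0, so no
    neighbourhood of the support could be cut out by \<open>infdist\<close>.\<close>
  case True
  then have "?X = (\<integral>\<^sup>+x. 0 \<partial>outer_to_measure \<mu>)"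
    by (intro nn_integral_cong) (auto simp: indicator_def)
  then show ?thesis by simp
next
  case False
  let ?M = "outer_to_measure \<mu>"
  define K where "K = closure {x \<in> B. u x \<noteq> 0}"
  have K: "compact K" "K \<noteq> {}" "K \<subseteq> B" using supp False by (auto simp: K_def)
  have u0: "u x = 0" if "x \<in> B" "x \<notin> K" for x
    using that closure_subset[of "{x \<in> B. u x \<noteq> 0}"] by (auto simp: K_def)
  obtain \<rho> where \<rho>: "0 < \<rho>" "{x. infdist x K \<le> 3 * \<rho>} \<subseteq> B"
    using compact_infdist_neighbourhood[OF K(1,2) B(1) K(3)] by blast
  let ?N = "{x. infdist x K \<le> 3 * \<rho>}" and ?S = "cutoff_shell K \<rho>"
  have closed_N: "closed ?N" by (intro closed_Collect_le continuous_intros)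
  have "compact (cball x0 R \<inter> ?N)"
    by (intro compact_Int_closed compact_cball_doubling[OF \<mu>] closed_N)
  moreover have "cball x0 R \<inter> ?N = ?N" using \<rho>(2) B(2) ball_subset_cball[of x0 R] by blast
  ultimately have N: "compact ?N" by simp
  have S_N: "?S \<subseteq> ?N" by (auto simp: cutoff_shell_def)
  have S_K: "x \<notin> K" if "x \<in> ?S" for x using that \<rho>(1) by (auto simp: cutoff_shell_def)
  have c: "0 < ?c" using \<open>0 < C\<^sub>P\<close> \<open>0 < R\<close> by (simp add: add_pos_nonneg)
  note borel_sets = borel_sets_outer_to_measure[OF \<mu>(1)]
  note borel_fun = borel_measurable_outer_to_measure[OF \<mu>(1)]
  have [measurable]: "B \<in> sets ?M" "?N \<in> sets ?M" "?S \<in> sets ?M" "ball x0 R \<in> sets ?M"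
    by (rule borel_sets, simp add: B(1) closed_N closed_cutoff_shell borel_closed borel_open)+
  have uB: "(\<lambda>x. indicator B x *\<^sub>R u x) \<in> borel_measurable ?M"
    using u by (simp add: set_integrable_def borel_measurable_integrable)
  have "?X \<le> ennreal ?c * liminf (\<lambda>i. \<integral>\<^sup>+x\<in>B. g i x \<partial>?M)"
    if v: "\<And>i. locally_lipschitz_on B (v i)" and g: "\<And>i. upper_gradient B (\<lambda>x. ereal (v i x)) (g i)"
      and conv: "L1loc_converges \<mu> B v u" for v g
  proof (rule ennreal_le_liminf_of_perturbed[OF c])
    \<comment> \<open>One error serves twice: for replacing \<open>u\<close> by \<open>v i\<close>
      on \<open>K\<close>, and for the cutoff term on the shell. Both sets lie in the compact set
      \<open>?N\<close>.\<close>
    let ?e = "\<lambda>i. \<integral>\<^sup>+x\<in>?N. ennreal \<bar>v i x - u x\<bar> \<partial>?M"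
    show "?e \<longlonglongrightarrow> 0" using conv N \<rho>(2) by (simp add: L1loc_converges_def)
    show "1 + ennreal ?c * ennreal (1 / \<rho>) \<noteq> top" by (simp add: ennreal_mult_eq_top_iff)
    fix i
    have cont: "continuous_on B (v i)" by (rule locally_lipschitz_imp_continuous_on[OF B(1) v])
    let ?w = "\<lambda>x. cutoff K \<rho> x * v i x"
    let ?G = "\<lambda>x. g i x * indicator B x + ennreal (\<bar>v i x\<bar> / \<rho>) * indicator ?S x"
    have w_out: "?w x = 0" if "2 * \<rho> < infdist x K" for x
      using that \<rho>(1) by (simp add: cutoff_eq_0)
    \<comment> \<open>Nothing is known about \<open>v i\<close> outside \<open>B\<close>. There the
      product is 0 because of the cutoff, and \<open>B\<close> together with the open region away
      from \<open>K\<close> covers X.\<close>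
    have "continuous_on (B \<union> {x. 2 * \<rho> < infdist x K}) ?w"
    proof (rule continuous_on_open_Un[OF B(1)])
      show "open {x. 2 * \<rho> < infdist x K}" by (intro open_Collect_less continuous_intros)
      show "continuous_on B ?w" by (intro continuous_intros continuous_on_cutoff cont)
      show "continuous_on {x. 2 * \<rho> < infdist x K} ?w"
        by (rule continuous_on_cong[THEN iffD2, OF refl _ continuous_on_const[of _ 0]]) (simp add: w_out)
    qed
    moreover have "B \<union> {x. 2 * \<rho> < infdist x K} = UNIV"
    proof -
      have "x \<in> B" if "\<not> 2 * \<rho> < infdist x K" for x using that \<rho> by auto
      then show ?thesis by auto
    qed
    ultimately have w_cont: "continuous_on UNIV ?w" by simp
    have w_zero: "?w x = 0" if "x \<in> ball y0 s" for x
    proof (rule w_out)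
      have "x \<notin> B" using that B(3) by blast
      then show "2 * \<rho> < infdist x K" using \<rho> by force
    qed
    have w_ug: "upper_gradient UNIV (\<lambda>x. ereal (?w x)) ?G"
      by (rule upper_gradient_cutoff_mult[OF B(1) g cont \<rho>(1) N \<rho>(2)])
    have [measurable]: "(\<lambda>x. g i x * indicator B x) \<in> borel_measurable ?M"
      using g[of i] B(1)
      by (intro borel_fun) (simp add: upper_gradient_def borel_measurable_restrict_space_iff_ennreal)
    have "(\<lambda>x. v i x * indicator ?N x) \<in> borel_measurable ?M"
      by (intro borel_fun borel_measurable_times_indicator continuous_on_subset[OF cont \<rho>(2)])
         (use closed_N in auto)
    \<comment> \<open>Measurability of \<open>u\<close> and \<open>v i\<close> is available only
      inside \<open>B\<close>, so both are cut down by indicators before they are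
      subtracted.\<close>
    then have "(\<lambda>x. ennreal \<bar>v i x * indicator ?N x - (indicator B x *\<^sub>R u x) * indicator ?N x\<bar>) \<in> borel_measurable ?M"
      using uB by measurable
    also have "(\<lambda>x. ennreal \<bar>v i x * indicator ?N x - (indicator B x *\<^sub>R u x) * indicator ?N x\<bar>)
        = (\<lambda>x. ennreal \<bar>v i x - u x\<bar> * indicator ?N x)"
      using \<rho>(2) by (auto simp: indicator_def fun_eq_iff)
    finally have diff [measurable]: "(\<lambda>x. ennreal \<bar>v i x - u x\<bar> * indicator ?N x) \<in> borel_measurable ?M" .
    have w_meas [measurable]: "?w \<in> borel_measurable ?M"
      by (rule borel_fun[OF borel_measurable_continuous_onI[OF w_cont]])
    \<comment> \<open>The shell avoids \<open>K\<close>, so \<open>u\<close> is 0 on it and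
      \<open>\<bar>v i\<bar>\<close> is the distance to the limit: the cutoff term becomes part of
      the L1 error.\<close>
    have shell: "ennreal (\<bar>v i x\<bar> / \<rho>) * indicator ?S x
        = ennreal (1 / \<rho>) * (ennreal \<bar>v i x - u x\<bar> * indicator ?S x)" for x
    proof (cases "x \<in> ?S")
      case True
      then have "u x = 0" using S_K S_N \<rho>(2) u0 by blast
      then show ?thesis using True \<rho>(1) by (simp add: ennreal_mult[symmetric])
    qed simp
    have shell_meas [measurable]: "(\<lambda>x. ennreal \<bar>v i x - u x\<bar> * indicator ?S x) \<in> borel_measurable ?M"
    proof -
      have "ennreal \<bar>v i x - u x\<bar> * indicator ?S x = ennreal \<bar>v i x - u x\<bar> * indicator ?N x * indicator ?S x" for x
        using S_N by (auto simp: indicator_def)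
      then show ?thesis by simp
    qed
    have "(\<integral>\<^sup>+x. ?G x \<partial>?M) = (\<integral>\<^sup>+x\<in>B. g i x \<partial>?M) +
        ennreal (1 / \<rho>) * (\<integral>\<^sup>+x\<in>?S. ennreal \<bar>v i x - u x\<bar> \<partial>?M)"
      unfolding shell by (subst nn_integral_add) (auto simp: nn_integral_cmult)
    also have "\<dots> \<le> (\<integral>\<^sup>+x\<in>B. g i x \<partial>?M) + ennreal (1 / \<rho>) * ?e i"
      using S_N by (intro add_left_mono mult_left_mono nn_integral_mono) (auto simp: indicator_def)
    finally have G: "(\<integral>\<^sup>+x. ?G x \<partial>?M) \<le> (\<integral>\<^sup>+x\<in>B. g i x \<partial>?M) + ennreal (1 / \<rho>) * ?e i" .
    have "?X \<le> (\<integral>\<^sup>+x. ennreal \<bar>v i x - u x\<bar> * indicator ?N x + ennreal \<bar>?w x\<bar> * indicator (ball x0 R) x \<partial>?M)"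
    proof (rule nn_integral_mono)
      fix x
      show "ennreal \<bar>u x\<bar> * indicator B x
          \<le> ennreal \<bar>v i x - u x\<bar> * indicator ?N x + ennreal \<bar>?w x\<bar> * indicator (ball x0 R) x"
      \<comment> \<open>On \<open>K\<close> the cutoff is 1, so \<open>?w\<close> is
        \<open>v i\<close> and the triangle inequality applies; at the remaining points of
        \<open>B\<close> the left side is 0.\<close>
      proof (cases "x \<in> K")
        case True
        then have "x \<in> B" "x \<in> ?N" "x \<in> ball x0 R" using K(3) B(2) \<rho>(1) by auto
        moreover have "cutoff K \<rho> x = 1" using True \<rho>(1) by (simp add: cutoff_eq_1)
        moreover have "ennreal \<bar>u x\<bar> \<le> ennreal (\<bar>v i x - u x\<bar> + \<bar>v i x\<bar>)" by (intro ennreal_leI) linarith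
        ultimately show ?thesis by simp
      next
        case False
        then show ?thesis using u0[of x] by (simp add: indicator_def)
      qed
    qed
    also have "\<dots> = ?e i + (\<integral>\<^sup>+x\<in>ball x0 R. ennreal \<bar>?w x\<bar> \<partial>?M)"
      by (rule nn_integral_add) measurable
    also have "\<dots> \<le> ?e i + ennreal ?c * (\<integral>\<^sup>+x. ?G x \<partial>?M)"
      by (intro add_left_mono poincare_zero_on_ball[OF \<mu> poincare assms(5-8) w_cont w_ug w_zero sub big])
    also have "\<dots> \<le> ?e i + ennreal ?c * ((\<integral>\<^sup>+x\<in>B. g i x \<partial>?M) + ennreal (1 / \<rho>) * ?e i)"
      by (intro add_left_mono mult_left_mono G) simp
    also have "\<dots> = ennreal ?c * (\<integral>\<^sup>+x\<in>B. g i x \<partial>?M) + (1 + ennreal ?c * ennreal (1 / \<rho>)) * ?e i"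
      by (simp only: distrib_left distrib_right mult_1 ac_simps)
    finally show "?X \<le> ennreal ?c * (\<integral>\<^sup>+x\<in>B. g i x \<partial>?M) + (1 + ennreal ?c * ennreal (1 / \<rho>)) * ?e i" .
  qed
  \<comment> \<open>The bound holds for every competitor \<open>v\<close>, \<open>g\<close>. In
    divided form it makes the left side a lower bound for the set whose infimum is the total
    variation.\<close>
  then have "?X / ennreal ?c \<le> total_variation \<mu> B u"
    unfolding total_variation_def using c
    by (intro INF_greatest) (auto intro!: divide_le_posI_ennreal)
  then show ?thesis by (rule ennreal_le_mult_of_divide_le[OF c])
qed

theorem corollary5p2:
  fixes x0 :: "'a::complete_space" and r C\<^sub>D C\<^sub>P \<tau> :: real
  assumes "0 < r" and "- closure (ball x0 r) \<noteq> {}"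
    and "0 < C\<^sub>P" and "1 \<le> \<tau>"
  shows "\<exists>C\<ge>1. \<forall>\<mu> :: 'a set \<Rightarrow> ennreal.
           borel_regular_outer_measure \<mu> \<and> positive_finite_on_balls \<mu> \<and>
           doubling_measure \<mu> C\<^sub>D \<and> weak_poincare11 \<mu> C\<^sub>P \<tau> \<longrightarrow>
           (\<forall>E. E \<subseteq> ball x0 r \<longrightarrow>
              comparable_with C (cap_BV_O \<mu> E (ball x0 r)) (Cap_BV_O \<mu> E (ball x0 r)))"
proof -
  let ?B = "ball x0 r"
  obtain y0 where "y0 \<in> - closure ?B" using assms(2) by blast
  then obtain s where s: "0 < s" "ball y0 s \<subseteq> - closure ?B"
    using open_contains_ball[of "- closure ?B"] by auto
  then have disj: "ball y0 s \<inter> ?B = {}" using closure_subset[of ?B] by blast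
  \<comment> \<open>Large enough for \<open>ball x0 R\<close> to contain both \<open>B\<close> and
    the exterior ball around \<open>y0\<close>.\<close>
  define R where "R = r + dist x0 y0 + s"
  have R: "0 < R" using assms(1) s(1) by (simp add: R_def add_pos_nonneg)
  have B_R: "?B \<subseteq> ball x0 R" using s(1) by (intro subset_ball) (simp add: R_def)
  have sub: "ball y0 s \<subseteq> ball x0 R"
  proof
    fix z assume "z \<in> ball y0 s"
    then show "z \<in> ball x0 R"
      using dist_triangle[of x0 z y0] assms(1) by (simp add: R_def)
  qed
  \<comment> \<open>Points of \<open>ball x0 R\<close> are within \<open>R + dist x0 y0\<close> of
    \<open>y0\<close>, so \<open>k\<close> is the number of doublings after which the exterior ball
    contains the large one.\<close>
  obtain k where "(R + dist x0 y0) / s < 2 ^ k" using real_arch_pow[of 2] by auto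
  then have k: "R + dist x0 y0 \<le> 2 ^ k * s" using s(1) by (simp add: field_simps)
  have big: "ball x0 R \<subseteq> ball y0 (2 ^ k * s)"
  proof
    fix z assume "z \<in> ball x0 R"
    then show "z \<in> ball y0 (2 ^ k * s)"
      using dist_triangle[of y0 z x0] k by (simp add: dist_commute)
  qed
  \<comment> \<open>\<open>y0\<close>, \<open>s\<close>, \<open>R\<close> and \<open>k\<close> were
    obtained from the ball before any measure is introduced, so this \<open>c\<close> serves all
    admissible \<open>\<mu>\<close> and all \<open>E\<close> at once.\<close>
  define c where "c = C\<^sub>P * R * (1 + max 0 C\<^sub>D ^ k)"
  have c: "0 \<le> c" using assms(3) R by (simp add: c_def)
  have "comparable_with (1 + c) (cap_BV_O \<mu> E ?B) (Cap_BV_O \<mu> E ?B)"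
    if \<mu>: "borel_regular_outer_measure \<mu>" "positive_finite_on_balls \<mu>" "doubling_measure \<mu> C\<^sub>D"
      "weak_poincare11 \<mu> C\<^sub>P \<tau>" for \<mu> :: "'a set \<Rightarrow> ennreal" and E
  proof -
    have "cap_BV_O \<mu> E ?B \<le> Cap_BV_O \<mu> E ?B"
      unfolding cap_BV_O_def Cap_BV_O_def by (rule INF_superset_mono) auto
    moreover have "ennreal (inverse (1 + c)) \<le> 1"
      using c by (simp add: inverse_le_1_iff)
    ultimately have lower: "ennreal (inverse (1 + c)) * cap_BV_O \<mu> E ?B \<le> Cap_BV_O \<mu> E ?B"
      using mult_mono[of "ennreal (inverse (1 + c))" 1 "cap_BV_O \<mu> E ?B" "Cap_BV_O \<mu> E ?B"] by simp
    \<comment> \<open>Both capacities range over the same test functions, so it suffices to compare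
      them for each \<open>u\<close>: the L1 term costs \<open>c\<close> times the total variation,
      which is itself the remaining summand.\<close>
    have "Cap_BV_O \<mu> E ?B / ennreal (1 + c) \<le> cap_BV_O \<mu> E ?B"
      unfolding cap_BV_O_def
    proof (rule INF_greatest)
      fix u assume u: "u \<in> cap_test_functions \<mu> E ?B"
      have "(\<integral>\<^sup>+x\<in>?B. ennreal \<bar>u x\<bar> \<partial>outer_to_measure \<mu>) \<le> ennreal c * total_variation \<mu> ?B u"
        unfolding c_def using u
        by (intro poincare_compact_support[OF \<mu> assms(3,4) R s(1) open_ball B_R disj sub big])
           (auto simp: cap_test_functions_def BV_def)
      then have "(\<integral>\<^sup>+x\<in>?B. ennreal \<bar>u x\<bar> \<partial>outer_to_measure \<mu>) + total_variation \<mu> ?B u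
          \<le> ennreal c * total_variation \<mu> ?B u + total_variation \<mu> ?B u"
        by (rule add_right_mono)
      also have "\<dots> = ennreal (1 + c) * total_variation \<mu> ?B u"
        using c by (simp add: distrib_right add.commute)
      finally have "Cap_BV_O \<mu> E ?B \<le> ennreal (1 + c) * total_variation \<mu> ?B u"
        unfolding Cap_BV_O_def by (rule INF_lower2[OF u])
      then show "Cap_BV_O \<mu> E ?B / ennreal (1 + c) \<le> total_variation \<mu> ?B u"
        using c by (intro divide_le_posI_ennreal) (simp_all del: ennreal_plus)
    qed
    then have "Cap_BV_O \<mu> E ?B \<le> ennreal (1 + c) * cap_BV_O \<mu> E ?B"
      using c by (intro ennreal_le_mult_of_divide_le) auto
    with lower show ?thesis by (simp add: comparable_with_def)
  qed
  then show ?thesis using c by (intro exI[of _ "1 + c"]) auto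
qed

end
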